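(* Let $X$ be a nonzero complex Banach space with open unit ball $\mathbb{B}$. Let $f:\mathbb{B}\to\mathbb{C}$ be holomorphic with $f(0)=1$ and suppose $F(z)=zf(z)$ belongs to $\mathcal{S}^*(\mathbb{B})$. Then for every $z\in X\setminus\{0\}$ and $l_z\in T(z)$, $$|A_2A_3-A_4|\le2,$$ where $$A_2=\frac{l_z(D^2F(0)(z^2))}{2!\,\|z\|^2},\quad A_3=\frac{l_z(D^3F(0)(z^3))}{3!\,\|z\|^3},\quad A_4=\frac{l_z(D^4F(0)(z^4))}{4!\,\|z\|^4}.$$ Equality is attained by the mapping $$\tilde F_2(z)=\frac{z}{(1-l_u(z))^2},\qquad z\in\mathbb{B},$$ where $u\in X$, $\|u\|=1$ and $l_u\in T(u)$. Hence the bound is sharp.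
   Context: For $z\in X\setminus\{0\}$, $T(z)=\{l_z\in L(X,\mathbb{C}): l_z(z)=\|z\|,\ \|l_z\|=1\}$, where $L(X,\mathbb{C})$ is the space of continuous linear functionals on $X$. $D^nF(0)$ is the $n$-th Fréchet derivative at $0$ and $D^nF(0)(z^n)=D^nF(0)(z,\dots,z)$. A holomorphic mapping $F:\mathbb{B}\to X$ is normalized if $F(0)=0$ and $DF(0)=I$, and locally biholomorphic if $DF(z)$ is invertible with bounded inverse for each $z\in\mathbb{B}$. $\mathcal{S}^*(\mathbb{B})$ (starlike mappings) is the class of normalized locally biholomorphic $F$ such that $\dfrac{\|z\|}{l_z([DF(z)]^{-1}F(z))}\in\Phi(\mathbb{U})$ for all $z\in\mathbb{B}\setminus\{0\}$, $l_z\in T(z)$, where $\mathbb{U}$ is the open unit disk and $\Phi(\zeta)=\frac{1+\zeta}{1-\zeta}$ (so $\Phi(\mathbb{U})$ is the open right half-plane). "Equality is attained by" a mapping means that the mapping satisfies the hypotheses on $F$ and that equality holds for it at some $z\in X\setminus\{0\}$ (namely $z=ru$, $0<r<1$). *)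

theory Defs
  imports "HOL-Complex_Analysis.Complex_Analysis"
begin

text \<open>The distribution has real Banach spaces only; a complex Banach space is a real one with a
  compatible complex scalar multiplication.\<close>

class scaleC =
  fixes scaleC :: "complex \<Rightarrow> 'a \<Rightarrow> 'a"  (infixr \<open>*\<^sub>C\<close> 75)

class complex_normed_vector = real_normed_vector + scaleC +
  assumes scaleC_add_right: "a *\<^sub>C (x + y) = a *\<^sub>C x + a *\<^sub>C y"
    and scaleC_add_left: "(a + b) *\<^sub>C x = a *\<^sub>C x + b *\<^sub>C x"
    and scaleC_scaleC: "a *\<^sub>C (b *\<^sub>C x) = (a * b) *\<^sub>C x"
    and scaleC_one: "1 *\<^sub>C x = x"
    and scaleR_scaleC: "r *\<^sub>R x = complex_of_real r *\<^sub>C x"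
    and norm_scaleC: "norm (a *\<^sub>C x) = cmod a * norm x"

class complex_banach = complex_normed_vector + banach

instantiation complex :: complex_banach
begin

definition scaleC_complex :: "complex \<Rightarrow> complex \<Rightarrow> complex"
  where "scaleC_complex a x = a * x"

instance
  by standard (auto simp: scaleC_complex_def algebra_simps scaleR_conv_of_real norm_mult)

end

definition clinear :: "('a::complex_normed_vector \<Rightarrow> 'b::complex_normed_vector) \<Rightarrow> bool"
  where "clinear g \<longleftrightarrow> linear g \<and> (\<forall>c x. g (c *\<^sub>C x) = c *\<^sub>C g x)"

text \<open>A complex Frechet derivative is a real one that is complex linear.  Only used for open \<open>S\<close>.\<close>

definition Cholomorphic_on ::
    "('a::complex_normed_vector \<Rightarrow> 'b::complex_normed_vector) \<Rightarrow> 'a set \<Rightarrow> bool"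
    (infix \<open>Cholomorphic'_on\<close> 50)
  where "F Cholomorphic_on S \<longleftrightarrow> (\<forall>z\<in>S. \<exists>D. (F has_derivative D) (at z) \<and> clinear D)"

text \<open>The Frechet derivative as an operator-valued map; iterating it gives the higher Frechet
  derivatives, with \<open>fderiv (fderiv F) :: 'a \<Rightarrow> 'a \<Rightarrow>\<^sub>L 'a \<Rightarrow>\<^sub>L 'b\<close> and so on.\<close>

definition fderiv ::
    "('a::real_normed_vector \<Rightarrow> 'b::real_normed_vector) \<Rightarrow> 'a \<Rightarrow> 'a \<Rightarrow>\<^sub>L 'b"
  where "fderiv F z = Blinfun (frechet_derivative F (at z))"

text \<open>Support functionals \<open>T(z)\<close>, used for \<open>z \<noteq> 0\<close>.  The norm of \<open>'a \<Rightarrow>\<^sub>L complex\<close> is the operator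
  norm.\<close>

definition support_functionals :: "'a::complex_normed_vector \<Rightarrow> ('a \<Rightarrow>\<^sub>L complex) set"
  where "support_functionals z =
    {l. clinear (blinfun_apply l) \<and> blinfun_apply l z = of_real (norm z) \<and> norm l = 1}"

definition normalized :: "('a::complex_normed_vector \<Rightarrow> 'a) \<Rightarrow> bool"
  where "normalized F \<longleftrightarrow> F Cholomorphic_on (ball 0 1) \<and> F 0 = 0 \<and> fderiv F 0 = id_blinfun"

definition locally_biholomorphic :: "('a::complex_normed_vector \<Rightarrow> 'a) \<Rightarrow> bool"
  where "locally_biholomorphic F \<longleftrightarrow> F Cholomorphic_on (ball 0 1) \<and>
    (\<forall>z\<in>ball 0 1. bij (blinfun_apply (fderiv F z)) \<and>
                  bounded_linear (inv (blinfun_apply (fderiv F z))))"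

definition Phi :: "complex \<Rightarrow> complex"
  where "Phi \<zeta> = (1 + \<zeta>) / (1 - \<zeta>)"

text \<open>A vanishing denominator below makes the quotient \<open>0\<close>, which is not in \<open>Phi ` ball 0 1\<close> (the
  open right half-plane), so the condition then fails, as it should.\<close>

definition starlike_maps :: "('a::complex_normed_vector \<Rightarrow> 'a) set"
  where "starlike_maps = {F. normalized F \<and> locally_biholomorphic F \<and>
    (\<forall>z\<in>ball 0 1 - {0}. \<forall>l\<in>support_functionals z.
       complex_of_real (norm z) / blinfun_apply l (inv (blinfun_apply (fderiv F z)) (F z))
         \<in> Phi ` ball 0 1)}"

definition scalar_starlike ::
    "('a::complex_normed_vector \<Rightarrow> complex) \<Rightarrow> ('a \<Rightarrow> 'a) \<Rightarrow> bool"
  where "scalar_starlike f F \<longleftrightarrow> f Cholomorphic_on (ball 0 1) \<and> f 0 = 1 \<and>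
    (\<forall>z\<in>ball 0 1. F z = f z *\<^sub>C z) \<and> F \<in> starlike_maps"

definition coeff2 :: "('a::complex_normed_vector \<Rightarrow> 'a) \<Rightarrow> 'a \<Rightarrow> ('a \<Rightarrow>\<^sub>L complex) \<Rightarrow> complex"
  where "coeff2 F z l =
    blinfun_apply l (blinfun_apply (blinfun_apply (fderiv (fderiv F) 0) z) z)
      / of_real (fact 2 * norm z ^ 2)"

definition coeff3 :: "('a::complex_normed_vector \<Rightarrow> 'a) \<Rightarrow> 'a \<Rightarrow> ('a \<Rightarrow>\<^sub>L complex) \<Rightarrow> complex"
  where "coeff3 F z l =
    blinfun_apply l
      (blinfun_apply (blinfun_apply (blinfun_apply (fderiv (fderiv (fderiv F)) 0) z) z) z)
      / of_real (fact 3 * norm z ^ 3)"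

definition coeff4 :: "('a::complex_normed_vector \<Rightarrow> 'a) \<Rightarrow> 'a \<Rightarrow> ('a \<Rightarrow>\<^sub>L complex) \<Rightarrow> complex"
  where "coeff4 F z l =
    blinfun_apply l
      (blinfun_apply (blinfun_apply (blinfun_apply (blinfun_apply
        (fderiv (fderiv (fderiv (fderiv F))) 0) z) z) z) z)
      / of_real (fact 4 * norm z ^ 4)"

end

theory Submission
  imports Defs
begin

text \<open>Fix a unit vector \<open>u\<close> with support functional \<open>l\<close>.  On the complex line through \<open>u\<close> the
  mapping \<open>F(z) = f(z) z\<close> is the scalar function \<open>h(\<zeta>) = \<zeta> g(\<zeta>)\<close>, where \<open>g(\<zeta>) = f(\<zeta> u)\<close>.  The
  operator \<open>DF(\<zeta> u)\<close> maps \<open>u\<close> to the multiple \<open>h'(\<zeta>) u\<close> of itself, so that the starlikeness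
  condition for \<open>F\<close> at \<open>\<zeta> u\<close> says that \<open>\<zeta> h'(\<zeta>) / h(\<zeta>)\<close> lies in the right half-plane: \<open>h\<close> is a
  starlike function of one variable (\<open>scalar_starlike_restricts_to_starlike_function\<close>).  The numbers
  \<open>A\<^sub>k\<close> are the Taylor coefficients \<open>a\<^sub>k\<close> of \<open>h\<close> (\<open>coeffs_eq_higher_deriv\<close>).

  For the scalar problem (\<open>starlike_coefficient_inequality\<close>) write
  \<open>\<zeta> h' / h = (1 + w) / (1 - w)\<close>.  By the Schwarz lemma \<open>w(\<zeta>) = \<zeta> \<phi>(\<zeta>)\<close> with \<open>\<bar>\<phi>\<bar> \<le> 1\<close>.  If
  \<open>\<phi> = b\<^sub>0 + b\<^sub>1 \<zeta> + b\<^sub>2 \<zeta>\<^sup>2 + \<dots>\<close>, comparing coefficients gives \<open>a\<^sub>2 = 2 b\<^sub>0\<close>,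
  \<open>a\<^sub>3 = b\<^sub>1 + 3 b\<^sub>0\<^sup>2\<close> and \<open>3 a\<^sub>4 = 2 b\<^sub>2 + 10 b\<^sub>0 b\<^sub>1 + 12 b\<^sub>0\<^sup>3\<close>, hence
  \<open>3 (a\<^sub>2 a\<^sub>3 - a\<^sub>4) = 6 b\<^sub>0\<^sup>3 - 4 b\<^sub>0 b\<^sub>1 - 2 b\<^sub>2\<close>.  Since \<open>\<bar>b\<^sub>n\<bar> \<le> 1 - \<bar>b\<^sub>0\<bar>\<^sup>2\<close> for \<open>n \<ge> 1\<close>
  (\<open>bounded_function_coeff_bound\<close>), the triangle inequality bounds the right-hand side by \<open>6\<close>.

  Identifying \<open>A\<^sub>k\<close> with \<open>a\<^sub>k\<close> requires that \<open>F\<close> really has iterated Frechet derivatives.  A mapping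
  that is complex differentiable once has a complex differentiable derivative
  (\<open>Cholomorphic_fderiv\<close>); this is derived from scalar Cauchy estimates on complex lines, tested
  against enough functionals to recover the norm.  The Hahn-Banach theorem supplies those
  functionals, and also the support functional without which the extremal mapping could not be
  written down.

  The extremal mapping restricts on the line through \<open>u\<close> to the Koebe function
  \<open>\<zeta> / (1 - \<zeta>)\<^sup>2 = \<Sum> n \<zeta>\<^sup>n\<close>, for which \<open>a\<^sub>2 a\<^sub>3 - a\<^sub>4 = 2 \<cdot> 3 - 4 = 2\<close>.  It is starlike because its
  derivative is a rank-one perturbation of a multiple of the identity and can be inverted explicitly;
  the starlikeness quotient at \<open>z\<close> turns out to be \<open>Phi (l\<^sub>u z)\<close>.\<close>

section \<open>Norming and support functionals\<close>

definition sublinear :: "('a::real_vector \<Rightarrow> real) \<Rightarrow> bool"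
  where "sublinear p \<longleftrightarrow> (\<forall>x y. p (x + y) \<le> p x + p y) \<and> (\<forall>c\<ge>0. \<forall>x. p (c *\<^sub>R x) \<le> c * p x)"

lemma sublinear_add: "sublinear p \<Longrightarrow> p (x + y) \<le> p x + p y"
  and sublinear_scale: "sublinear p \<Longrightarrow> 0 \<le> c \<Longrightarrow> p (c *\<^sub>R x) \<le> c * p x"
  by (auto simp: sublinear_def)

lemma sublinear_zero: assumes "sublinear p" shows "p 0 = 0"
  using sublinear_add[OF assms, of 0 0] sublinear_scale[OF assms, of 0 0] by simp

lemma sublinear_minus: assumes "sublinear p" shows "- p (- x) \<le> p x"
  using sublinear_add[OF assms, of x "- x"] sublinear_zero[OF assms] by simp

lemma sublinear_scale_eq:
  assumes p: "sublinear p" and c: "0 \<le> c" shows "p (c *\<^sub>R x) = c * p x"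
proof (cases "c = 0")
  case False
  then show ?thesis
    using sublinear_scale[OF p, of "1 / c" "c *\<^sub>R x"] sublinear_scale[OF p c, of x] c
    by (simp add: field_simps)
qed (simp add: sublinear_zero[OF p])

text \<open>The largest sublinear minorant \<open>q\<close> of \<open>p\<close> with \<open>q (- y) \<le> - p y\<close>, that is, the one forced
  to be linear along the line through \<open>y\<close>.\<close>

definition tilt :: "('a::real_vector \<Rightarrow> real) \<Rightarrow> 'a \<Rightarrow> 'a \<Rightarrow> real"
  where "tilt p y x = (INF t\<in>{0..}. p (x + t *\<^sub>R y) - t * p y)"

lemma
  assumes p: "sublinear p"
  shows tilt_sublinear: "sublinear (tilt p y)"
    and tilt_le: "tilt p y x \<le> p x"
    and tilt_minus: "tilt p y (- y) \<le> - p y"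
proof -
  have bd: "- p (- x) \<le> p (x + t *\<^sub>R y) - t * p y" if "t \<ge> 0" for x t
    using sublinear_add[OF p, of "x + t *\<^sub>R y" "- x"] sublinear_scale_eq[OF p that, of y]
    by (simp add: algebra_simps)
  have bdd: "bdd_below ((\<lambda>t. p (x + t *\<^sub>R y) - t * p y) ` {0..})" for x
    by (rule bdd_belowI[of _ "- p (- x)"]) (use bd in auto)
  have le: "tilt p y x \<le> p (x + t *\<^sub>R y) - t * p y" if "t \<ge> 0" for x t
    unfolding tilt_def by (rule cINF_lower[OF bdd]) (use that in auto)
  have ge: "c \<le> tilt p y x" if "\<And>t. t \<ge> 0 \<Longrightarrow> c \<le> p (x + t *\<^sub>R y) - t * p y" for c x
    unfolding tilt_def by (rule cINF_greatest) (use that in auto)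
  show "tilt p y x \<le> p x" using le[of 0 x] by simp
  show "tilt p y (- y) \<le> - p y" using le[of 1 "- y"] sublinear_zero[OF p] by simp
  have add: "tilt p y (x + x') \<le> tilt p y x + tilt p y x'" for x x'
  proof -
    have "tilt p y (x + x') - (p (x + t *\<^sub>R y) - t * p y) \<le> tilt p y x'" if t: "t \<ge> 0" for t
    proof (rule ge)
      fix s :: real assume s: "s \<ge> 0"
      have "p ((x + x') + (t + s) *\<^sub>R y) \<le> p (x + t *\<^sub>R y) + p (x' + s *\<^sub>R y)"
        using sublinear_add[OF p, of "x + t *\<^sub>R y" "x' + s *\<^sub>R y"] by (simp add: algebra_simps)
      then show "tilt p y (x + x') - (p (x + t *\<^sub>R y) - t * p y) \<le> p (x' + s *\<^sub>R y) - s * p y"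
        using le[of "t + s" "x + x'"] s t by (simp add: algebra_simps)
    qed
    then have "tilt p y (x + x') - tilt p y x' \<le> tilt p y x"
      by (intro ge) (simp add: algebra_simps)
    then show ?thesis by simp
  qed
  have sc: "tilt p y (c *\<^sub>R x) \<le> c * tilt p y x" if c: "c \<ge> 0" for c x
  proof (cases "c = 0")
    case True
    then show ?thesis using le[of 0 0] sublinear_zero[OF p] by simp
  next
    case False
    have "tilt p y (c *\<^sub>R x) / c \<le> tilt p y x"
    proof (rule ge)
      fix t :: real assume t: "t \<ge> 0"
      have "p (c *\<^sub>R x + (c * t) *\<^sub>R y) = c * p (x + t *\<^sub>R y)"
        using sublinear_scale_eq[OF p c, of "x + t *\<^sub>R y"] by (simp add: algebra_simps)
      then show "tilt p y (c *\<^sub>R x) / c \<le> p (x + t *\<^sub>R y) - t * p y"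
        using le[of "c * t" "c *\<^sub>R x"] c t False by (simp add: field_simps)
    qed
    then show ?thesis using c False by (simp add: field_simps)
  qed
  show "sublinear (tilt p y)"
    unfolding sublinear_def using add sc by auto
qed

text \<open>Tilting a minimal sublinear functional in any direction cannot change it, so it is already odd, and
  an odd sublinear functional is additive.\<close>

lemma linear_if_minimal_sublinear:
  assumes m: "sublinear m"
    and min: "\<And>q. sublinear q \<Longrightarrow> (\<And>x. q x \<le> m x) \<Longrightarrow> q = m"
  shows "linear m"
proof -
  have neg: "m (- y) = - m y" for y
  proof -
    have "tilt m y = m" by (intro min tilt_sublinear[OF m] tilt_le[OF m])
    then show ?thesis using tilt_minus[OF m, of y] sublinear_minus[OF m, of "y"] by simp
  qed
  show ?thesis
  proof (rule linearI)
    show "m (x + y) = m x + m y" for x y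
      using sublinear_add[OF m, of x y] sublinear_add[OF m, of "x + y" "- y"] neg[of y] by simp
    show "m (c *\<^sub>R x) = c *\<^sub>R m x" for c x
    proof (cases "c \<ge> 0")
      case False
      then show ?thesis
        using sublinear_scale_eq[OF m, of "- c" x] neg[of "c *\<^sub>R x"] by simp
    qed (simp add: sublinear_scale_eq[OF m])
  qed
qed

text \<open>Zorn's lemma produces a minimal sublinear minorant: the pointwise infimum of a chain is again
  sublinear, because any two members of the chain are comparable, and it stays finite because every
  member is bounded below by \<open>- p (- x)\<close>.  Working with minimal functionals replaces the extension of
  partially defined functionals in the usual proof of the Hahn-Banach theorem.\<close>

lemma linear_minorant_of_sublinear:
  assumes p: "sublinear p"
  obtains m where "linear m" "\<And>x. m x \<le> p x"
proof -
  define A where "A = {q. sublinear q \<and> (\<forall>x. q x \<le> p x)}"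
  have po: "partial_order_on A (relation_of (\<ge>) A)"
    by (rule partial_order_on_relation_ofI) auto
  have "\<exists>m\<in>A. \<forall>a\<in>A. m \<ge> a \<longrightarrow> a = m"
  proof (rule predicate_Zorn[OF po])
    fix C assume C: "C \<in> Chains (relation_of (\<ge>) A)"
    show "\<exists>u\<in>A. \<forall>a\<in>C. u \<le> a"
    proof (cases "C = {}")
      case True
      then show ?thesis using p by (auto simp: A_def)
    next
      case False
      have CA: "q \<in> A" if "q \<in> C" for q
        using C that by (auto simp: Chains_def relation_of_def)
      have tot: "q \<le> q' \<or> q' \<le> q" if "q \<in> C" "q' \<in> C" for q q'
        using C that by (auto simp: Chains_def relation_of_def)
      define u where "u x = (INF q\<in>C. q x)" for x
      have bdd: "bdd_below ((\<lambda>q. q x) ` C)" for x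
      proof (rule bdd_belowI2)
        fix q assume "q \<in> C"
        then have "sublinear q" "q (- x) \<le> p (- x)" using CA by (auto simp: A_def)
        then show "- p (- x) \<le> q x" using sublinear_minus[of q x] by simp
      qed
      have le: "u x \<le> q x" if "q \<in> C" for q x
        unfolding u_def by (rule cINF_lower[OF bdd that])
      have ge: "c \<le> u x" if "\<And>q. q \<in> C \<Longrightarrow> c \<le> q x" for c x
        unfolding u_def by (rule cINF_greatest[OF False that])
      have "u (x + y) \<le> u x + u y" for x y
      proof -
        have *: "u (x + y) \<le> q x + q' y" if q: "q \<in> C" "q' \<in> C" for q q'
        proof -
          obtain r where r: "r \<in> C" "r \<le> q" "r \<le> q'" using tot[OF q] q by auto
          then have "sublinear r" using CA by (auto simp: A_def)
          then show ?thesis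
            using le[OF r(1), of "x + y"] sublinear_add[of r x y] le_funD[OF r(2), of x] le_funD[OF r(3), of y]
            by linarith
        qed
        have "u (x + y) - q x \<le> u y" if "q \<in> C" for q
          by (rule ge) (use *[OF that] in \<open>force simp: algebra_simps\<close>)
        then have "u (x + y) - u y \<le> u x"
          by (intro ge) (force simp: algebra_simps)
        then show ?thesis by simp
      qed
      moreover have "u (c *\<^sub>R x) \<le> c * u x" if c: "c \<ge> 0" for c x
      proof -
        have *: "u (c *\<^sub>R x) \<le> c * q x" if "q \<in> C" for q
          using le[OF that, of "c *\<^sub>R x"] sublinear_scale[of q c x] CA[OF that] c by (auto simp: A_def)
        show ?thesis
        proof (cases "c = 0")
          case True
          then show ?thesis using * False by auto
        next
          case False
          have "u (c *\<^sub>R x) / c \<le> u x"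
            by (rule ge) (use * c False in \<open>auto simp: field_simps\<close>)
          then show ?thesis using c False by (simp add: field_simps)
        qed
      qed
      moreover have "u x \<le> p x" for x
      proof -
        obtain q where "q \<in> C" using False by auto
        then show ?thesis using le[of q x] CA[of q] order_trans[of "u x" "q x" "p x"] by (auto simp: A_def)
      qed
      ultimately have "u \<in> A" by (auto simp: A_def sublinear_def)
      then show ?thesis using le by (auto simp: le_fun_def)
    qed
  qed
  then obtain m where m: "m \<in> A" and min: "\<And>a. a \<in> A \<Longrightarrow> a \<le> m \<Longrightarrow> a = m" by auto
  have "linear m"
  proof (rule linear_if_minimal_sublinear)
    show "q = m" if "sublinear q" "\<And>x. q x \<le> m x" for q
    proof (rule min)
      show "q \<in> A" using that m unfolding A_def by (blast intro: order_trans)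
    qed (use that in \<open>auto simp: le_fun_def\<close>)
  qed (use m in \<open>auto simp: A_def\<close>)
  then show thesis using that m by (auto simp: A_def)
qed

text \<open>Tilting the norm along \<open>x0\<close> before passing to a linear minorant forces equality at \<open>x0\<close>.\<close>

lemma real_norming_functional:
  fixes x0 :: "'a::real_normed_vector"
  obtains m :: "'a \<Rightarrow> real" where "linear m" "\<And>x. m x \<le> norm x" "m x0 = norm x0"
proof -
  have p: "sublinear (norm :: 'a \<Rightarrow> real)"
    by (auto simp: sublinear_def norm_triangle_ineq)
  obtain m where m: "linear m" "\<And>x. m x \<le> tilt norm x0 x"
    using linear_minorant_of_sublinear[OF tilt_sublinear[OF p]] by blast
  have le: "m x \<le> norm x" for x using m(2)[of x] tilt_le[OF p, of x0 x] by linarith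
  have "- m x0 \<le> - norm x0"
    using m(2)[of "- x0"] tilt_minus[OF p, of x0] linear_neg[OF m(1), of x0] by simp
  then show thesis using that[OF m(1) le] le[of x0] by simp
qed

lemma clinear_zero: "clinear g \<Longrightarrow> g 0 = 0"
  and clinear_add: "clinear g \<Longrightarrow> g (x + y) = g x + g y"
  and clinear_diff: "clinear g \<Longrightarrow> g (x - y) = g x - g y"
  and clinear_scaleC: "clinear g \<Longrightarrow> g (c *\<^sub>C x) = c *\<^sub>C g x"
  by (auto simp: clinear_def linear_0 linear_add linear_diff)

lemma scaleC_ii_ii: "\<i> *\<^sub>C \<i> *\<^sub>C x = - (x::'a::complex_normed_vector)"
  using scaleR_scaleC[of "-1" x] by (simp add: scaleC_scaleC)

text \<open>Plain functions are used here instead of bounded linear operators so that functionals on operator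
  spaces can be written as lambda terms.\<close>

definition dual_ball :: "('a::complex_normed_vector \<Rightarrow> complex) set"
  where "dual_ball = {l. clinear l \<and> (\<forall>x. cmod (l x) \<le> norm x)}"

text \<open>A real functional \<open>m\<close> is the real part of the complex functional \<open>m x - \<i> m (\<i> x)\<close>.  Rotating \<open>x\<close>
  until the value becomes a nonnegative real number transfers the bound from \<open>m\<close>.\<close>

lemma norming_functional:
  fixes x0 :: "'a::complex_normed_vector"
  obtains l where "l \<in> dual_ball" "l x0 = of_real (norm x0)"
proof -
  obtain m :: "'a \<Rightarrow> real" where m: "linear m" "\<And>x. m x \<le> norm x" "m x0 = norm x0"
    using real_norming_functional[of x0] by blast
  define l where "l x = Complex (m x) (- m (\<i> *\<^sub>C x))" for x
  have add: "l (x + y) = l x + l y" for x y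
    by (simp add: l_def complex_eq_iff linear_add[OF m(1)] scaleC_add_right)
  have lR: "l (complex_of_real r *\<^sub>C x) = of_real r * l x" for r x
  proof -
    have "\<i> *\<^sub>C complex_of_real r *\<^sub>C x = r *\<^sub>R \<i> *\<^sub>C x"
      by (simp add: scaleR_scaleC scaleC_scaleC mult.commute)
    then show ?thesis
      using linear_cmul[OF m(1)] by (simp add: l_def complex_eq_iff flip: scaleR_scaleC)
  qed
  have lI: "l (\<i> *\<^sub>C x) = \<i> * l x" for x
    by (simp add: l_def complex_eq_iff scaleC_ii_ii linear_neg[OF m(1)])
  have lC: "l (c *\<^sub>C x) = c * l x" for c x
  proof -
    have "c *\<^sub>C x = of_real (Re c) *\<^sub>C x + \<i> *\<^sub>C (of_real (Im c) *\<^sub>C x)"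
      by (simp add: scaleC_scaleC flip: scaleC_add_left complex_eq)
    then have "l (c *\<^sub>C x) = (of_real (Re c) + \<i> * of_real (Im c)) * l x"
      by (simp add: add lI lR algebra_simps)
    then show ?thesis by (simp flip: complex_eq)
  qed
  have cl: "clinear l"
    unfolding clinear_def
    by (auto intro!: linearI simp: add lC scaleC_complex_def scaleR_scaleC scaleR_conv_of_real)
  have bd: "cmod (l x) \<le> norm x" for x
  proof (cases "l x = 0")
    case False
    define c where "c = cnj (sgn (l x))"
    have c: "cmod c = 1" using False by (simp add: c_def norm_sgn)
    have "c * l x = of_real (cmod (l x))"
      using False complex_norm_square[of "l x"]
      by (simp add: c_def sgn_eq field_simps power2_eq_square)
    then have "cmod (l x) = Re (l (c *\<^sub>C x))" by (simp add: lC)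
    also have "\<dots> \<le> norm (c *\<^sub>C x)" by (simp add: l_def m(2))
    also have "\<dots> = norm x" by (simp add: norm_scaleC c)
    finally show ?thesis .
  qed simp
  have re: "Re (l x0) = norm x0" by (simp add: l_def m(3))
  \<comment> \<open>the real part alone already exhausts the bound on the modulus\<close>
  have "(Im (l x0))\<^sup>2 \<le> 0"
    using bd[of x0] cmod_power2[of "l x0"] re power_mono[OF bd[of x0], of 2] by simp
  then have "l x0 = of_real (norm x0)" using re by (simp add: complex_eq_iff)
  then show thesis using that cl bd by (auto simp: dual_ball_def)
qed

lemma bounded_linear_dual_ball: "l \<in> dual_ball \<Longrightarrow> bounded_linear l"
  by (auto simp: dual_ball_def clinear_def linear_conv_bounded_linear[symmetric] 
        intro!: bounded_linear_intro[of _ 1] linear_add linear_scale simp: linear_cmul)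

lemma support_functional_exists:
  fixes u :: "'a::complex_normed_vector"
  assumes "u \<noteq> 0"
  obtains l where "l \<in> support_functionals u"
proof -
  obtain l where l: "l \<in> dual_ball" "l u = of_real (norm u)"
    using norming_functional[of u] by blast
  have bl: "blinfun_apply (Blinfun l) = l"
    using bounded_linear_Blinfun_apply[OF bounded_linear_dual_ball[OF l(1)]] .
  have "norm (Blinfun l) \<le> 1"
    by (rule norm_blinfun_bound) (use l in \<open>auto simp: bl dual_ball_def\<close>)
  moreover have "norm u \<le> norm (Blinfun l) * norm u"
    using norm_blinfun[of "Blinfun l" u] l(2) by (simp add: bl)
  ultimately have "norm (Blinfun l) = 1" using assms by simp
  then show thesis using that[of "Blinfun l"] l by (auto simp: support_functionals_def bl dual_ball_def)
qed

section \<open>Bounded and starlike functions of one variable\<close>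

lemma has_integral_norm_one_plus_rotation_squared:
  assumes n: "n \<ge> (1::nat)"
  shows "((\<lambda>x. (cmod (1 + \<mu> * exp (2 * of_real pi * \<i> * of_nat n * of_real x)))\<^sup>2)
           has_integral 1 + (cmod \<mu>)\<^sup>2) {0..1}"
proof -
  define c where "c = 2 * of_real pi * \<i> * of_nat n"
  have c0: "c \<noteq> 0" using n by (simp add: c_def)
  have c1: "exp c = 1"
    using exp_integer_2pi[of "of_nat n"] by (simp add: c_def mult_ac)
  have "((\<lambda>x. \<mu> * exp (c * of_real x)) has_integral
          \<mu> * exp (c * of_real 1) / c - \<mu> * exp (c * of_real 0) / c) {0..1::real}"
    by (rule fundamental_theorem_of_calculus)
      (auto intro!: derivative_eq_intros has_vector_derivative_real_field simp: c0)
  then have "((\<lambda>x. \<mu> * exp (c * of_real x)) has_integral 0) {0..1::real}" by (simp add: c1)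
  from has_integral_linear[OF this bounded_linear_Re]
  have "((\<lambda>x. Re (\<mu> * exp (c * of_real x))) has_integral 0) {0..1::real}"
    by (simp only: o_def zero_complex.sel)
  then have "((\<lambda>x. (1 + (cmod \<mu>)\<^sup>2) + 2 * Re (\<mu> * exp (c * of_real x)))
      has_integral (1 + (cmod \<mu>)\<^sup>2) + 2 * 0) {0..1::real}"
    using has_integral_const_real[of "1 + (cmod \<mu>)\<^sup>2" 0 1]
    by (intro has_integral_add[of "\<lambda>x. 1 + (cmod \<mu>)\<^sup>2"] has_integral_mult_right) simp_all
  moreover have "(cmod (1 + \<mu> * exp (c * of_real x)))\<^sup>2
      = (1 + (cmod \<mu>)\<^sup>2) + 2 * Re (\<mu> * exp (c * of_real x))" for x :: real
  proof -
    have "(cmod (1 + w))\<^sup>2 = 1 + (cmod w)\<^sup>2 + 2 * Re w" for w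
      by (simp only: cmod_power2) (simp add: power2_eq_square algebra_simps)
    moreover have "cmod (exp (c * of_real x)) = 1" by (simp add: c_def norm_exp_eq_Re)
    ultimately show ?thesis by (simp add: norm_mult)
  qed
  ultimately show ?thesis by (simp add: c_def)
qed

text \<open>Inside the modulus on the left stands the \<open>n\<close>-th Taylor coefficient of \<open>\<phi>(z) (1 + \<kappa> z\<^sup>n)\<^sup>2\<close>.  Cauchy's formula
  bounds it by the mean of \<open>\<bar>1 + \<kappa> z\<^sup>n\<bar>\<^sup>2\<close> over a circle of radius \<open>r < 1\<close>, which is
  \<open>1 + \<bar>\<kappa>\<bar>\<^sup>2 r\<^sup>2\<^sup>n\<close>; then let \<open>r\<close> tend to \<open>1\<close>.\<close>

lemma norm_coeff_mean_value_le:
  assumes hol: "\<phi> holomorphic_on ball 0 1"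
    and bd: "\<And>z. cmod z < 1 \<Longrightarrow> cmod (\<phi> z) \<le> 1"
    and n: "n \<ge> 1"
  shows "cmod ((deriv ^^ n) \<phi> 0 / fact n + 2 * \<kappa> * \<phi> 0) \<le> 1 + (cmod \<kappa>)\<^sup>2"
proof -
  define G where "G z = \<phi> z * (1 + \<kappa> * z ^ n)\<^sup>2" for z
  have holG: "G holomorphic_on ball 0 1"
    unfolding G_def by (intro holomorphic_intros hol)
  define B where "B = fps_expansion \<phi> 0"
  have B: "\<phi> has_fps_expansion B"
    unfolding B_def by (rule has_fps_expansion_fps_expansion[OF _ _ hol]) auto
  have "G has_fps_expansion B * (1 + fps_const \<kappa> * fps_X ^ n)\<^sup>2"
    unfolding G_def by (intro fps_expansion_intros B)
  then have "(deriv ^^ n) G 0 / fact n = (B * (1 + fps_const \<kappa> * fps_X ^ n)\<^sup>2) $ n"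
    by (simp add: fps_nth_fps_expansion)
  also have "B * (1 + fps_const \<kappa> * fps_X ^ n)\<^sup>2
      = B + (fps_const (2 * \<kappa>) * B) * fps_X ^ n + (fps_const (\<kappa>\<^sup>2) * B) * fps_X ^ (2 * n)"
  proof -
    have "fps_const (2 * \<kappa>) = 2 * fps_const \<kappa>" "fps_const (\<kappa>\<^sup>2) = fps_const \<kappa> ^ 2"
      by (simp_all add: numeral_fps_const fps_const_power)
    moreover have "fps_X ^ (2 * n) = (fps_X ^ n :: complex fps) ^ 2"
      by (metis power_mult mult.commute)
    ultimately show ?thesis by (simp only: power2_eq_square ring_distribs mult_1 mult_1_right mult_2 mult_ac add_ac)
  qed
  also have "\<dots> $ n = B $ n + 2 * \<kappa> * B $ 0"
    using n by (simp add: fps_X_power_mult_right_nth)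
  finally have coeff: "(deriv ^^ n) G 0 / fact n = (deriv ^^ n) \<phi> 0 / fact n + 2 * \<kappa> * \<phi> 0"
    using fps_nth_fps_expansion[OF B, of n] fps_nth_fps_expansion[OF B, of 0] by simp
  define D where "D = (deriv ^^ n) G 0 / fact n"
  have main: "cmod D * r ^ n \<le> 1 + (cmod (\<kappa> * of_real r ^ n))\<^sup>2" if r: "0 < r" "r < 1" for r :: real
  proof -
    have "((\<lambda>u. G u / (u - 0) ^ (Suc n)) has_contour_integral (2 * pi * \<i>) / fact n * (deriv ^^ n) G 0)
            (circlepath 0 r)"
      by (rule Cauchy_has_contour_integral_higher_derivative_circlepath)
        (use r holG in \<open>auto intro!: holomorphic_on_imp_continuous_on intro: holomorphic_on_subset\<close>)
    then have I: "((\<lambda>x. G (circlepath 0 r x) / circlepath 0 r x ^ Suc n *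
        (2 * pi * \<i> * r * exp (2 * of_real pi * \<i> * x))) has_integral 2 * pi * \<i> * D) {0..1}"
      unfolding has_contour_integral_def
      by (rule has_integral_eq_rhs[OF has_integral_eq[rotated]])
        (simp_all add: vector_derivative_circlepath01 D_def)
    let ?\<mu> = "\<kappa> * of_real r ^ n"
    have J: "((\<lambda>x. 2 * pi / r ^ n * (cmod (1 + ?\<mu> * exp (2 * of_real pi * \<i> * of_nat n * of_real x)))\<^sup>2)
        has_integral 2 * pi / r ^ n * (1 + (cmod ?\<mu>)\<^sup>2)) {0..1}"
      by (intro has_integral_mult_right has_integral_norm_one_plus_rotation_squared n)
    have pt: "cmod (G (circlepath 0 r x) / circlepath 0 r x ^ Suc n * (2 * pi * \<i> * r * exp (2 * of_real pi * \<i> * x)))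
       \<le> 2 * pi / r ^ n * (cmod (1 + ?\<mu> * exp (2 * of_real pi * \<i> * of_nat n * of_real x)))\<^sup>2" for x
    proof -
      define u where "u = circlepath 0 r x"
      have u: "u = r * exp (2 * of_real pi * \<i> * x)" by (simp add: u_def circlepath)
      have e: "cmod (exp (2 * of_real pi * \<i> * x)) = 1" by (simp add: norm_exp_eq_Re)
      have nu: "cmod u = r" using r e by (simp add: u norm_mult)
      have un: "u ^ n = of_real r ^ n * exp (2 * of_real pi * \<i> * of_nat n * of_real x)"
        by (simp add: u power_mult_distrib mult_ac flip: exp_of_nat_mult)
      have "cmod (G u / u ^ Suc n * (2 * pi * \<i> * r * exp (2 * of_real pi * \<i> * x)))
          = cmod (\<phi> u) * (2 * pi / r ^ n * (cmod (1 + \<kappa> * u ^ n))\<^sup>2)"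
        using r by (simp add: G_def norm_mult norm_divide norm_power nu e field_simps)
      also have "\<dots> \<le> 1 * (2 * pi / r ^ n * (cmod (1 + \<kappa> * u ^ n))\<^sup>2)"
        using bd[of u] nu r by (intro mult_right_mono) auto
      finally show ?thesis by (simp add: u_def[symmetric] un mult.assoc)
    qed
    have "cmod (integral {0..1} (\<lambda>x. G (circlepath 0 r x) / circlepath 0 r x ^ Suc n *
        (2 * pi * \<i> * r * exp (2 * of_real pi * \<i> * x)))) \<le> integral {0..1} 
       (\<lambda>x. 2 * pi / r ^ n * (cmod (1 + ?\<mu> * exp (2 * of_real pi * \<i> * of_nat n * of_real x)))\<^sup>2)"
      by (rule integral_norm_bound_integral[OF has_integral_integrable[OF I] has_integral_integrable[OF J] pt])
    then have "cmod (2 * pi * \<i> * D) \<le> 2 * pi / r ^ n * (1 + (cmod ?\<mu>)\<^sup>2)"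
      by (simp only: integral_unique[OF I] integral_unique[OF J])
    also have "cmod (2 * pi * \<i> * D) = 2 * pi * cmod D" by (simp add: norm_mult)
    finally have "2 * pi * (cmod D * r ^ n) \<le> 2 * pi * (1 + (cmod ?\<mu>)\<^sup>2)"
      using r by (simp only: times_divide_eq_left pos_le_divide_eq zero_less_power mult.assoc)
    then show ?thesis using pi_gt_zero by (simp only: mult_le_cancel_left_pos)
  qed
  have L: "((\<lambda>r. cmod D * r ^ n) \<longlongrightarrow> cmod D * 1 ^ n) (at_left 1)"
    by (intro tendsto_intros)
  have U: "((\<lambda>r. 1 + (cmod (\<kappa> * of_real r ^ n))\<^sup>2) \<longlongrightarrow> 1 + (cmod (\<kappa> * of_real 1 ^ n))\<^sup>2) (at_left (1::real))"
    by (intro tendsto_intros)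
  have "\<forall>\<^sub>F r in at_left (1::real). cmod D * r ^ n \<le> 1 + (cmod (\<kappa> * of_real r ^ n))\<^sup>2"
    using eventually_at_left_real[of 0 1] by (rule eventually_mono) (auto intro: main)
  from tendsto_le[OF trivial_limit_at_left_real U L this]
  have "cmod D * 1 ^ n \<le> 1 + (cmod (\<kappa> * of_real 1 ^ n))\<^sup>2" .
  then show ?thesis by (simp add: D_def coeff)
qed

text \<open>F. Wiener's inequality.  Choose \<open>\<kappa>\<close> in the mean value estimate with modulus \<open>\<bar>\<phi>(0)\<bar>\<close> and with the
  argument that aligns the two summands.\<close>

lemma bounded_function_coeff_bound:
  assumes hol: "\<phi> holomorphic_on ball 0 1"
    and bd: "\<And>z. cmod z < 1 \<Longrightarrow> cmod (\<phi> z) \<le> 1"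
    and n: "n \<ge> 1"
  shows "cmod ((deriv ^^ n) \<phi> 0 / fact n) \<le> 1 - (cmod (\<phi> 0))\<^sup>2"
proof -
  define b where "b = (deriv ^^ n) \<phi> 0 / fact n"
  define c where "c = \<phi> 0"
  have key: "cmod (b + 2 * \<kappa> * c) \<le> 1 + (cmod \<kappa>)\<^sup>2" for \<kappa>
    unfolding b_def c_def by (rule norm_coeff_mean_value_le[OF hol bd n])
  show ?thesis
  proof (cases "b = 0")
    case True
    then show ?thesis using bd[of 0] by (simp add: b_def power_le_one)
  next
    case False
    have "b + 2 * (cnj c * sgn b) * c = sgn b * of_real (cmod b + 2 * (cmod c)\<^sup>2)"
      using False complex_norm_square[of c] by (simp add: sgn_eq field_simps)
    then have "cmod (b + 2 * (cnj c * sgn b) * c) = cmod b + 2 * (cmod c)\<^sup>2"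
      using False by (simp add: norm_mult norm_sgn del: of_real_add)
    moreover have "cmod (cnj c * sgn b) = cmod c"
      using False by (simp add: norm_mult norm_sgn)
    ultimately show ?thesis
      using key[of "cnj c * sgn b"] unfolding b_def[symmetric] c_def[symmetric] by simp
  qed
qed

text \<open>Taylor's formula on the disc of radius \<open>R / 2\<close>; the derivatives there are controlled by Cauchy's
  inequality on circles of radius \<open>R / 4\<close>, which explains the constants.\<close>

lemma
  assumes hol: "g holomorphic_on ball 0 R" and bd: "\<And>z. cmod z < R \<Longrightarrow> cmod (g z) \<le> M" and R: "R > 0"
  shows bounded_disc_deriv_bound: "cmod (deriv g 0) \<le> 4 * M / R"
    and bounded_disc_lipschitz: "cmod t \<le> R / 2 \<Longrightarrow> cmod (g t - g 0) \<le> 4 * M / R * cmod t"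
    and bounded_disc_taylor:
      "cmod t \<le> R / 2 \<Longrightarrow> cmod (g t - g 0 - deriv g 0 * t) \<le> 32 * M / R\<^sup>2 * (cmod t)\<^sup>2"
proof -
  have est: "cmod ((deriv ^^ n) g z) \<le> fact n * M / (R / 4) ^ n" if z: "cmod z \<le> R / 2" for z n
  proof (rule Cauchy_inequality)
    have sub: "cball z (R / 4) \<subseteq> ball 0 R"
      using z R by (auto simp: subset_iff dist_norm) (smt (verit) norm_minus_commute norm_triangle_sub field_sum_of_halves)
    then show "g holomorphic_on ball z (R / 4)" "continuous_on (cball z (R / 4)) g"
      using holomorphic_on_subset[OF hol sub] ball_subset_cball[of z "R / 4"]
      by (auto intro: holomorphic_on_imp_continuous_on holomorphic_on_subset)
    show "cmod (g x) \<le> M" if "cmod (z - x) = R / 4" for x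
      using sub that by (intro bd) (auto simp: subset_iff dist_norm)
  qed (use R in auto)
  show "cmod (deriv g 0) \<le> 4 * M / R"
    using est[of 0 1] R by (simp add: field_simps)
  have der: "((deriv ^^ n) g has_field_derivative (deriv ^^ Suc n) g z) (at z within cball 0 (R / 2))"
    if "z \<in> cball 0 (R / 2)" for z n
  proof -
    have "(deriv ^^ n) g holomorphic_on ball 0 R"
      by (rule holomorphic_higher_deriv[OF hol]) auto
    then show ?thesis
      using holomorphic_derivI[of "(deriv ^^ n) g" "ball 0 R" z] that R
      by (auto intro: has_field_derivative_at_within)
  qed
  have tay: "cmod (g t - (\<Sum>i\<le>n. (deriv ^^ i) g 0 * (t - 0) ^ i / fact i))
      \<le> (fact (Suc n) * M / (R / 4) ^ Suc n) * cmod (t - 0) ^ Suc n / fact n"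
    if "cmod t \<le> R / 2" for n
    using complex_Taylor[of "cball 0 (R / 2)" n "\<lambda>i. (deriv ^^ i) g" "fact (Suc n) * M / (R / 4) ^ Suc n" 0 t]
      der est[of _ "Suc n"] that R by simp
  show "cmod (g t - g 0) \<le> 4 * M / R * cmod t" if "cmod t \<le> R / 2"
    using tay[OF that, of 0] by (simp add: field_simps)
  show "cmod (g t - g 0 - deriv g 0 * t) \<le> 32 * M / R\<^sup>2 * (cmod t)\<^sup>2" if "cmod t \<le> R / 2"
    using tay[OF that, of 1] by (simp add: field_simps power2_eq_square)
qed

text \<open>With \<open>a = \<bar>b\<^sub>0\<bar>\<close> the triangle inequality leaves
  \<open>6 a\<^sup>3 + 4 a (1 - a\<^sup>2) + 2 (1 - a\<^sup>2) = 6 - 2 (1 - a) (2 + a\<^sup>2)\<close>.\<close>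

lemma schwarz_coefficients_inequality:
  fixes b0 b1 b2 :: complex
  assumes "cmod b0 \<le> 1" and b1: "cmod b1 \<le> 1 - (cmod b0)\<^sup>2" and b2: "cmod b2 \<le> 1 - (cmod b0)\<^sup>2"
  shows "cmod (6 * b0 ^ 3 - 4 * b0 * b1 - 2 * b2) \<le> 6"
proof -
  define a where "a = cmod b0"
  have a: "0 \<le> a" "a \<le> 1" using assms by (auto simp: a_def)
  have "cmod (6 * b0 ^ 3 - 4 * b0 * b1 - 2 * b2) \<le> cmod (6 * b0 ^ 3) + cmod (4 * b0 * b1) + cmod (2 * b2)"
    by (meson norm_triangle_ineq4 order_trans add_right_mono)
  also have "\<dots> = 6 * a ^ 3 + 4 * a * cmod b1 + 2 * cmod b2"
    by (simp add: norm_mult norm_power a_def)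
  also have "\<dots> \<le> 6 * a ^ 3 + 4 * a * (1 - a\<^sup>2) + 2 * (1 - a\<^sup>2)"
    using b1 b2 a by (intro add_mono mult_left_mono) (auto simp: a_def)
  also have "\<dots> = 6 - 2 * ((1 - a) * (2 + a\<^sup>2))"
    by (simp add: power2_eq_square power3_eq_cube algebra_simps)
  also have "\<dots> \<le> 6" using a by simp
  finally show ?thesis .
qed

text \<open>For \<open>h(\<zeta>) = \<zeta> g(\<zeta>)\<close> the quotient in the hypothesis is \<open>\<zeta> h' / h\<close>.  Writing it as \<open>Phi w\<close> gives
  \<open>w = \<zeta> \<phi>\<close> with \<open>\<phi> = g' / (2 g + \<zeta> g')\<close>.  This form of \<open>\<phi>\<close> is holomorphic at \<open>0\<close>
  as well, and clearing its denominator yields the recursion for the coefficients.\<close>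

lemma starlike_coefficient_inequality:
  assumes hol: "g holomorphic_on ball 0 1" and g0: "g 0 = 1"
    and star: "\<And>\<zeta>. \<zeta> \<in> ball 0 1 \<Longrightarrow> \<zeta> \<noteq> 0 \<Longrightarrow> (g \<zeta> + \<zeta> * deriv g \<zeta>) / g \<zeta> \<in> Phi ` ball 0 1"
  defines "a \<equiv> \<lambda>n. (deriv ^^ n) (\<lambda>\<zeta>. \<zeta> * g \<zeta>) 0 / fact n"
  shows "cmod (a 2 * a 3 - a 4) \<le> 2"
proof -
  \<comment> \<open>away from \<open>0\<close> this is \<open>g (1 + Phi w)\<close>, and \<open>Phi\<close> omits the value \<open>-1\<close>, so \<open>den\<close> never vanishes\<close>
  define den where "den \<zeta> = 2 * g \<zeta> + \<zeta> * deriv g \<zeta>" for \<zeta>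
  have W: "den \<zeta> \<noteq> 0 \<and> cmod (\<zeta> * deriv g \<zeta> / den \<zeta>) < 1" if z: "\<zeta> \<in> ball 0 1" for \<zeta>
  proof (cases "\<zeta> = 0")
    case True
    then show ?thesis by (simp add: den_def g0)
  next
    case False
    obtain w where w: "cmod w < 1" and eq: "(g \<zeta> + \<zeta> * deriv g \<zeta>) / g \<zeta> = Phi w"
      using star[OF z False] by auto
    have "w \<noteq> 1" "w \<noteq> - 1" using w by auto
    then have w1: "1 - w \<noteq> 0" "1 + w \<noteq> 0" by (simp_all add: add_eq_0_iff)
    \<comment> \<open>division by zero would give the value \<open>0\<close>, which is not of the form \<open>Phi w\<close> with \<open>\<bar>w\<bar> < 1\<close>\<close>
    have gn: "g \<zeta> \<noteq> 0" using eq w1 by (auto simp: Phi_def)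
    have sum: "g \<zeta> + \<zeta> * deriv g \<zeta> = g \<zeta> * (1 + w) / (1 - w)"
      using eq gn by (simp add: Phi_def field_simps)
    have "g \<zeta> * (1 + w) / (1 - w) - g \<zeta> = g \<zeta> * (2 * w) / (1 - w)"
    proof -
      have "g \<zeta> = g \<zeta> * (1 - w) / (1 - w)" using w1 by simp
      then have "g \<zeta> * (1 + w) / (1 - w) - g \<zeta> = (g \<zeta> * (1 + w) - g \<zeta> * (1 - w)) / (1 - w)"
        by (metis diff_divide_distrib)
      then show ?thesis by (simp add: algebra_simps)
    qed
    with sum have z1: "\<zeta> * deriv g \<zeta> = g \<zeta> * (2 * w) / (1 - w)"
      by (metis add_diff_cancel_left')
    have "den \<zeta> = 2 * g \<zeta> + g \<zeta> * (2 * w) / (1 - w)" by (simp only: den_def z1)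
    then have "den \<zeta> = 2 * g \<zeta> / (1 - w)" using w1 by (simp add: field_simps)
    then show ?thesis using z1 w1 gn w by simp
  qed
  define \<phi> where "\<phi> \<zeta> = deriv g \<zeta> / den \<zeta>" for \<zeta>
  have holden: "den holomorphic_on ball 0 1" and hold: "deriv g holomorphic_on ball 0 1"
    unfolding den_def by (intro holomorphic_intros holomorphic_deriv hol open_ball)+
  have holphi: "\<phi> holomorphic_on ball 0 1"
    unfolding \<phi>_def using W by (intro holomorphic_intros hold holden) auto
  have holW: "(\<lambda>\<zeta>. \<zeta> * \<phi> \<zeta>) holomorphic_on ball 0 1" by (intro holomorphic_intros holphi)
  have Wb: "cmod (\<zeta> * \<phi> \<zeta>) < 1" if "cmod \<zeta> < 1" for \<zeta> using W[of \<zeta>] that by (simp add: \<phi>_def)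
  have bd: "cmod (\<phi> \<zeta>) \<le> 1" if z: "cmod \<zeta> < 1" for \<zeta>
  proof (cases "\<zeta> = 0")
    case True
    have "(\<phi> has_field_derivative deriv \<phi> 0) (at 0)"
      by (rule holomorphic_derivI[OF holphi]) auto
    then have "((\<lambda>\<zeta>. \<zeta> * \<phi> \<zeta>) has_field_derivative \<phi> 0) (at 0)"
      by (auto intro!: derivative_eq_intros)
    then show ?thesis using Schwarz_Lemma(2)[OF holW _ Wb, of 0] True by (simp add: DERIV_imp_deriv)
  next
    case False
    then show ?thesis using Schwarz_Lemma(1)[OF holW _ Wb z] by (simp add: norm_mult)
  qed
  define B where "B = fps_expansion \<phi> 0"
  have B: "\<phi> has_fps_expansion B"
    unfolding B_def by (rule has_fps_expansion_fps_expansion[OF _ _ holphi]) auto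
  define G where "G = fps_expansion g 0"
  have G: "g has_fps_expansion G"
    unfolding G_def by (rule has_fps_expansion_fps_expansion[OF _ _ hol]) auto
  have G0: "G $ 0 = 1" using fps_nth_fps_expansion[OF G, of 0] g0 by simp
  have "(\<lambda>\<zeta>. \<phi> \<zeta> * den \<zeta>) has_fps_expansion B * (2 * G + fps_X * fps_deriv G)"
    unfolding den_def by (intro fps_expansion_intros B G)
  moreover have "(\<lambda>\<zeta>. \<phi> \<zeta> * den \<zeta>) has_fps_expansion fps_deriv G
      \<longleftrightarrow> deriv g has_fps_expansion fps_deriv G"
  proof (rule has_fps_expansion_cong[OF _ refl])
    show "\<forall>\<^sub>F x in nhds 0. \<phi> x * den x = deriv g x"
      using eventually_nhds_in_open[of "ball 0 1" "0::complex"]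
      by (rule eventually_mono) (use W in \<open>auto simp: \<phi>_def\<close>)
  qed
  ultimately have "(\<lambda>\<zeta>. \<phi> \<zeta> * den \<zeta>) has_fps_expansion B * (2 * G + fps_X * fps_deriv G)"
      "(\<lambda>\<zeta>. \<phi> \<zeta> * den \<zeta>) has_fps_expansion fps_deriv G"
    using has_fps_expansion_deriv[OF G] by simp_all
  from this[THEN fps_nth_fps_expansion]
  have fps: "B * (2 * G + fps_X * fps_deriv G) = fps_deriv G"
    by (intro fps_ext) (simp only:)
  have c: "(B * (2 * G + fps_X * fps_deriv G)) $ k = (fps_deriv G) $ k" for k by (simp add: fps)
  have e0: "G $ 1 = 2 * B $ 0" using c[of 0] G0 by (simp add: mult.commute)
  have e1: "2 * G $ 2 = 2 * B $ 1 + 3 * B $ 0 * G $ 1"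
    using c[of 1] G0 by (simp add: fps_mult_nth fps_numeral_nth numeral_2_eq_2 algebra_simps)
  have e2: "3 * G $ 3 = 2 * B $ 2 + 3 * B $ 1 * G $ 1 + 4 * B $ 0 * G $ 2"
    using c[of 2] G0 by (simp add: fps_mult_nth fps_numeral_nth numeral_2_eq_2 numeral_3_eq_3 algebra_simps)
  have h: "(\<lambda>\<zeta>. \<zeta> * g \<zeta>) has_fps_expansion fps_X * G" by (intro fps_expansion_intros G)
  have a: "a (Suc k) = G $ k" for k
    using fps_nth_fps_expansion[OF h, of "Suc k"] by (simp add: a_def)
  have "a 2 = G $ 1" "a 3 = G $ 2" "a 4 = G $ 3"
    using a[of 1] a[of 2] a[of 3] by (simp_all add: numeral_eq_Suc)
  moreover have "3 * (G $ 1 * G $ 2 - G $ 3) = 6 * (B $ 0) ^ 3 - 4 * B $ 0 * B $ 1 - 2 * B $ 2"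
  proof -
    have "2 * G $ 2 = 2 * (B $ 1 + 3 * (B $ 0)\<^sup>2)"
      unfolding e1 e0 by (simp add: power2_eq_square algebra_simps)
    then have g2: "G $ 2 = B $ 1 + 3 * (B $ 0)\<^sup>2" by (simp only: mult_cancel_left) simp
    have "3 * (G $ 1 * G $ 2 - G $ 3) = 3 * G $ 1 * G $ 2 - 3 * G $ 3" by (simp add: algebra_simps)
    then show ?thesis
      unfolding e2 unfolding g2 e0 by (simp add: power2_eq_square power3_eq_cube algebra_simps)
  qed
  moreover have "cmod (6 * (B $ 0) ^ 3 - 4 * B $ 0 * B $ 1 - 2 * B $ 2) \<le> 6"
  proof (rule schwarz_coefficients_inequality)
    have b0: "B $ 0 = \<phi> 0" using fps_nth_fps_expansion[OF B, of 0] by simp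
    show "cmod (B $ 0) \<le> 1" using bd[of 0] b0 by simp
    have "cmod (B $ k) \<le> 1 - (cmod (\<phi> 0))\<^sup>2" if "k \<ge> 1" for k
      using bounded_function_coeff_bound[OF holphi bd that] fps_nth_fps_expansion[OF B, of k] by simp
    then show "cmod (B $ 1) \<le> 1 - (cmod (B $ 0))\<^sup>2" "cmod (B $ 2) \<le> 1 - (cmod (B $ 0))\<^sup>2"
      by (simp_all add: b0)
  qed
  ultimately have "cmod (3 * (a 2 * a 3 - a 4)) \<le> 6" by simp
  then show ?thesis by (simp only: norm_mult) simp
qed

section \<open>Holomorphic mappings between complex Banach spaces\<close>

lemma bounded_linear_scaleC: "bounded_linear (\<lambda>x::'a::complex_normed_vector. c *\<^sub>C x)"
  by (rule bounded_linear_intro[where K = "cmod c"])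
    (simp_all add: scaleC_add_right scaleR_scaleC scaleC_scaleC norm_scaleC mult.commute)

lemma bounded_bilinear_scaleC:
  "bounded_bilinear (\<lambda>c (x::'a::complex_normed_vector). c *\<^sub>C x)"
proof
  show "\<exists>K. \<forall>a (b::'a). norm (a *\<^sub>C b) \<le> norm a * norm b * K"
    by (rule exI[of _ 1]) (simp add: norm_scaleC)
  show "(r *\<^sub>R a) *\<^sub>C b = r *\<^sub>R a *\<^sub>C b" for r a and b :: 'a
    by (simp only: scaleR_scaleC[of r "a *\<^sub>C b"] scaleC_scaleC scaleR_conv_of_real)
  show "a *\<^sub>C r *\<^sub>R b = r *\<^sub>R a *\<^sub>C b" for r a and b :: 'a
    by (simp only: scaleR_scaleC scaleC_scaleC mult.commute)
qed (simp_all add: scaleC_add_right scaleC_add_left)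

lemma scaleC_zero_left: "0 *\<^sub>C x = (0::'a::complex_normed_vector)"
  using norm_scaleC[of 0 x] by simp

text \<open>Scalars act on the values of an operator.  With this structure \<open>fderiv F\<close> is again a mapping into a complex Banach space and complex
  differentiability can be iterated.\<close>

instantiation blinfun :: (real_normed_vector, complex_normed_vector) complex_normed_vector
begin

definition scaleC_blinfun :: "complex \<Rightarrow> ('a \<Rightarrow>\<^sub>L 'b) \<Rightarrow> ('a \<Rightarrow>\<^sub>L 'b)"
  where "scaleC_blinfun c A = Blinfun (\<lambda>x. c *\<^sub>C blinfun_apply A x)"

lemma scaleC_blinfun_apply: "blinfun_apply (c *\<^sub>C A) x = c *\<^sub>C blinfun_apply (A :: 'a \<Rightarrow>\<^sub>L 'b) x"
proof -
  have "bounded_linear (\<lambda>x. c *\<^sub>C blinfun_apply A x)"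
    by (rule bounded_linear_compose[OF bounded_linear_scaleC blinfun.bounded_linear_right])
  then show ?thesis by (simp add: scaleC_blinfun_def bounded_linear_Blinfun_apply)
qed

instance
proof
  fix a b :: complex and A B :: "'a \<Rightarrow>\<^sub>L 'b" and r :: real
  have le: "norm (c *\<^sub>C A) \<le> cmod c * norm A" for c and A :: "'a \<Rightarrow>\<^sub>L 'b"
  proof (rule norm_blinfun_bound)
    show "norm (blinfun_apply (c *\<^sub>C A) x) \<le> cmod c * norm A * norm x" for x
      using mult_left_mono[OF norm_blinfun[of A x] norm_ge_zero[of c]]
      by (simp add: scaleC_blinfun_apply norm_scaleC mult.assoc)
  qed simp
  show comp: "a *\<^sub>C b *\<^sub>C A = (a * b) *\<^sub>C A" for a b and A :: "'a \<Rightarrow>\<^sub>L 'b"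
    by (rule blinfun_eqI) (simp add: scaleC_blinfun_apply scaleC_scaleC)
  show one: "1 *\<^sub>C A = A" for A :: "'a \<Rightarrow>\<^sub>L 'b"
    by (rule blinfun_eqI) (simp add: scaleC_blinfun_apply scaleC_one)
  show "a *\<^sub>C (A + B) = a *\<^sub>C A + a *\<^sub>C B" "(a + b) *\<^sub>C A = a *\<^sub>C A + b *\<^sub>C A"
    by (rule blinfun_eqI; simp add: scaleC_blinfun_apply scaleC_add_right scaleC_add_left blinfun.add_left)+
  show "r *\<^sub>R A = complex_of_real r *\<^sub>C A"
    by (rule blinfun_eqI) (simp add: scaleC_blinfun_apply scaleR_scaleC blinfun.scaleR_left)
  show "norm (a *\<^sub>C A) = cmod a * norm A"
  proof (cases "a = 0")
    case True
    then show ?thesis using le[of a A] by simp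
  next
    case False
    have "norm A \<le> cmod (inverse a) * norm (a *\<^sub>C A)"
      using le[of "inverse a" "a *\<^sub>C A"] False by (simp add: comp one)
    then have "cmod a * norm A \<le> norm (a *\<^sub>C A)"
      unfolding norm_inverse using False by (simp add: field_simps)
    then show ?thesis using le[of a A] by simp
  qed
qed

end

instance blinfun :: (real_normed_vector, complex_banach) complex_banach ..

text \<open>A set of functionals of norm at most one that recovers the norm.  Two such sets occur: the whole
  dual ball, and on operator spaces the functionals that evaluate at a vector, for
  which holomorphy of \<open>fderiv F\<close> follows from holomorphy of \<open>F\<close> itself.\<close>

definition norming :: "('b::complex_normed_vector \<Rightarrow> complex) set \<Rightarrow> bool"
  where "norming N \<longleftrightarrow> N \<subseteq> dual_ball \<and> (\<forall>y. \<forall>C\<ge>0. (\<forall>l\<in>N. cmod (l y) \<le> C) \<longrightarrow> norm y \<le> C)"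

lemma norming_le: "norming N \<Longrightarrow> 0 \<le> C \<Longrightarrow> (\<And>l. l \<in> N \<Longrightarrow> cmod (l y) \<le> C) \<Longrightarrow> norm y \<le> C"
  by (auto simp: norming_def)

lemma norming_dual_ball: "norming dual_ball"
  unfolding norming_def
proof (intro conjI allI impI subset_refl)
  fix y :: 'a and C :: real assume "\<forall>l\<in>dual_ball. cmod (l y) \<le> C"
  then show "norm y \<le> C" using norming_functional[of y] by (metis norm_of_real abs_norm_cancel)
qed

definition evaluation_functionals :: "(('a::real_normed_vector \<Rightarrow>\<^sub>L 'b::complex_normed_vector) \<Rightarrow> complex) set"
  where "evaluation_functionals = {\<lambda>A. l (blinfun_apply A v) | l v. l \<in> dual_ball \<and> norm v \<le> 1}"

lemma norming_evaluation_functionals: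
  "norming (evaluation_functionals :: (('a::real_normed_vector \<Rightarrow>\<^sub>L 'b::complex_normed_vector) \<Rightarrow> complex) set)"
  unfolding norming_def
proof (intro conjI allI impI)
  show "(evaluation_functionals :: (('a \<Rightarrow>\<^sub>L 'b) \<Rightarrow> complex) set) \<subseteq> dual_ball"
  proof
    fix \<Lambda> :: "('a \<Rightarrow>\<^sub>L 'b) \<Rightarrow> complex" assume "\<Lambda> \<in> evaluation_functionals"
    then obtain l v where L: "\<Lambda> = (\<lambda>A. l (blinfun_apply A v))" and l: "l \<in> dual_ball" and v: "norm v \<le> 1"
      by (auto simp: evaluation_functionals_def)
    have cl: "clinear l" and bd: "cmod (l y) \<le> norm y" for y using l by (auto simp: dual_ball_def)
    have "clinear \<Lambda>"
      using linear_compose[OF bounded_linear.linear[OF blinfun.bounded_linear_left, of v], of l] cl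
      by (simp add: clinear_def L o_def scaleC_blinfun_apply)
    moreover have "cmod (\<Lambda> A) \<le> norm A" for A
      using bd[of "blinfun_apply A v"] norm_blinfun[of A v] mult_left_mono[OF v, of "norm A"]
      by (simp add: L)
    ultimately show "\<Lambda> \<in> dual_ball" by (simp add: dual_ball_def)
  qed
  fix A :: "'a \<Rightarrow>\<^sub>L 'b" and C :: real
  assume C: "0 \<le> C" and le: "\<forall>\<Lambda>\<in>evaluation_functionals. cmod (\<Lambda> A) \<le> C"
  have unit: "norm (blinfun_apply A v) \<le> C" if "norm v \<le> 1" for v
    by (rule norming_le[OF norming_dual_ball C]) (use le that in \<open>auto simp: evaluation_functionals_def\<close>)
  show "norm A \<le> C"
  proof (rule norm_blinfun_bound[OF C])
    fix x
    show "norm (blinfun_apply A x) \<le> C * norm x"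
    proof (cases "x = 0")
      case False
      then show ?thesis using unit[of "x /\<^sub>R norm x"] by (simp add: blinfun.scaleR_right field_simps)
    qed simp
  qed
qed

text \<open>Holomorphy along complex lines, tested against \<open>N\<close>.  Differentiability at the centre \<open>0\<close> suffices
  because the base point ranges over all of \<open>S\<close>.\<close>

definition weakly_holomorphic ::
    "('b::complex_normed_vector \<Rightarrow> complex) set \<Rightarrow> ('a::complex_normed_vector \<Rightarrow> 'b) \<Rightarrow> 'a set \<Rightarrow> bool"
  where "weakly_holomorphic N G S \<longleftrightarrow>
    (\<forall>l\<in>N. \<forall>x\<in>S. \<forall>h. (\<lambda>\<zeta>. l (G (x + \<zeta> *\<^sub>C h))) field_differentiable (at 0))"

lemma weakly_holomorphic_subset: "weakly_holomorphic N G S \<Longrightarrow> T \<subseteq> S \<Longrightarrow> weakly_holomorphic N G T"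
  by (auto simp: weakly_holomorphic_def)

lemma ball_half_subset: "y \<in> ball x (\<rho> / 2) \<Longrightarrow> ball y (\<rho> / 2) \<subseteq> ball x \<rho>"
proof
  fix w assume "y \<in> ball x (\<rho> / 2)" "w \<in> ball y (\<rho> / 2)"
  then show "w \<in> ball x \<rho>" using dist_triangle[of x w y] by simp
qed

lemma divide_nat_shift_tendsto_zero: "(\<lambda>n. K / real (n + m + 1)) \<longlonglongrightarrow> 0"
proof -
  have "(\<lambda>n. K * (1 / real (n + (m + 1)))) \<longlonglongrightarrow> K * 0"
    by (intro tendsto_mult tendsto_const LIMSEQ_ignore_initial_segment[OF lim_1_over_n])
  then show ?thesis by (simp add: add.assoc)
qed

lemma weakly_holomorphic_on_line:
  assumes wh: "weakly_holomorphic N G S" and l: "l \<in> N"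
    and T: "\<And>\<zeta>. \<zeta> \<in> T \<Longrightarrow> x + \<zeta> *\<^sub>C h \<in> S"
  shows "(\<lambda>\<zeta>. l (G (x + \<zeta> *\<^sub>C h))) holomorphic_on T"
  unfolding holomorphic_on_def
proof
  fix \<zeta>0 assume "\<zeta>0 \<in> T"
  then have "(\<lambda>\<zeta>. l (G ((x + \<zeta>0 *\<^sub>C h) + \<zeta> *\<^sub>C h))) field_differentiable (at (\<zeta>0 - \<zeta>0))"
    using wh l T by (auto simp: weakly_holomorphic_def)
  then have "(\<lambda>\<zeta>. l (G ((x + \<zeta>0 *\<^sub>C h) + \<zeta> *\<^sub>C h))) \<circ> (\<lambda>\<zeta>. \<zeta> - \<zeta>0) field_differentiable (at \<zeta>0)"
    by (intro field_differentiable_compose) (auto intro!: derivative_intros)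
  moreover have "(\<lambda>\<zeta>. l (G ((x + \<zeta>0 *\<^sub>C h) + \<zeta> *\<^sub>C h))) \<circ> (\<lambda>\<zeta>. \<zeta> - \<zeta>0) = (\<lambda>\<zeta>. l (G (x + \<zeta> *\<^sub>C h)))"
    by (simp add: o_def fun_eq_iff add.assoc flip: scaleC_add_left)
  ultimately show "(\<lambda>\<zeta>. l (G (x + \<zeta> *\<^sub>C h))) field_differentiable (at \<zeta>0 within T)"
    by (simp add: field_differentiable_at_within)
qed

lemma directional_deriv_scale:
  assumes wh: "weakly_holomorphic N G S" and l: "l \<in> N" and x: "x \<in> S"
  shows "deriv (\<lambda>\<zeta>. l (G (x + \<zeta> *\<^sub>C c *\<^sub>C h))) 0 = c * deriv (\<lambda>\<zeta>. l (G (x + \<zeta> *\<^sub>C h))) 0"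
proof -
  let ?g = "\<lambda>\<zeta>. l (G (x + \<zeta> *\<^sub>C h))"
  have "?g field_differentiable (at (0 * c))"
    using wh l x by (auto simp: weakly_holomorphic_def)
  then have "(?g has_field_derivative deriv ?g 0) (at (0 * c))"
    by (simp add: field_differentiable_derivI)
  then have "((\<lambda>\<zeta>. ?g (\<zeta> * c)) has_field_derivative deriv ?g 0 * c) (at 0)"
    by (rule DERIV_chain2[of ?g _ "\<lambda>\<zeta>. \<zeta> * c"]) (auto intro!: derivative_eq_intros)
  then show ?thesis by (simp add: DERIV_imp_deriv scaleC_scaleC mult.commute)
qed

text \<open>The function \<open>\<zeta> \<mapsto> l (G (x + \<zeta> h))\<close> is bounded by \<open>M\<close> on the disc of radius \<open>\<rho> / \<parallel>h\<parallel>\<close>; the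
  one-variable estimates at the point \<open>\<zeta> = 1\<close> become estimates that are uniform in \<open>l\<close> and \<open>h\<close>.\<close>

lemma
  assumes N: "N \<subseteq> dual_ball"
    and wh: "weakly_holomorphic N G (ball x \<rho>)" and \<rho>: "\<rho> > 0"
    and bd: "\<And>y. y \<in> ball x \<rho> \<Longrightarrow> norm (G y) \<le> M" and l: "l \<in> N"
  shows directional_deriv_bound:
      "cmod (deriv (\<lambda>\<zeta>. l (G (x + \<zeta> *\<^sub>C h))) 0) \<le> 4 * M / \<rho> * norm h"
    and directional_lipschitz:
      "norm h \<le> \<rho> / 2 \<Longrightarrow> cmod (l (G (x + h) - G x)) \<le> 4 * M / \<rho> * norm h"
    and directional_taylor:
      "norm h \<le> \<rho> / 2 \<Longrightarrow>
        cmod (l (G (x + h) - G x) - deriv (\<lambda>\<zeta>. l (G (x + \<zeta> *\<^sub>C h))) 0) \<le> 32 * M / \<rho>\<^sup>2 * (norm h)\<^sup>2"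
proof -
  have cl: "clinear l" and lb: "cmod (l y) \<le> norm y" for y using l N by (auto simp: dual_ball_def)
  let ?g = "\<lambda>\<zeta>. l (G (x + \<zeta> *\<^sub>C h))"
  have z: "(\<lambda>\<zeta>. l (G (x + \<zeta> *\<^sub>C h))) = (\<lambda>\<zeta>. l (G x))" if "h = 0"
    using that clinear_def norm_scaleC[of _ h] by (auto simp: fun_eq_iff)
  have ne: "cmod (deriv ?g 0) \<le> 4 * M / (\<rho> / norm h)
      \<and> (norm h \<le> \<rho> / 2 \<longrightarrow> cmod (?g 1 - ?g 0) \<le> 4 * M / (\<rho> / norm h) * cmod 1)
      \<and> (norm h \<le> \<rho> / 2 \<longrightarrow> cmod (?g 1 - ?g 0 - deriv ?g 0 * 1) \<le> 32 * M / (\<rho> / norm h)\<^sup>2 * (cmod 1)\<^sup>2)"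
    if h: "h \<noteq> 0"
  proof -
    have R: "\<rho> / norm h > 0" using h \<rho> by simp
    have inb: "x + \<zeta> *\<^sub>C h \<in> ball x \<rho>" if "cmod \<zeta> < \<rho> / norm h" for \<zeta>
      using that h by (simp add: dist_norm norm_scaleC field_simps)
    have hol: "?g holomorphic_on ball 0 (\<rho> / norm h)"
      by (rule weakly_holomorphic_on_line[OF wh l]) (use inb in auto)
    have bd': "cmod (?g \<zeta>) \<le> M" if "cmod \<zeta> < \<rho> / norm h" for \<zeta>
      using lb[of "G (x + \<zeta> *\<^sub>C h)"] bd[OF inb[OF that]] by linarith
    have one: "cmod 1 \<le> \<rho> / norm h / 2" if "norm h \<le> \<rho> / 2" using that h by (simp add: field_simps)
    show ?thesis
      using bounded_disc_deriv_bound[OF hol bd' R] bounded_disc_lipschitz[OF hol bd' R one]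
        bounded_disc_taylor[OF hol bd' R one] by blast
  qed
  show "cmod (deriv ?g 0) \<le> 4 * M / \<rho> * norm h"
    using ne z by (cases "h = 0") (auto simp: field_simps)
  show "cmod (l (G (x + h) - G x)) \<le> 4 * M / \<rho> * norm h" if "norm h \<le> \<rho> / 2"
    using ne that by (cases "h = 0") (auto simp: clinear_diff[OF cl] clinear_zero[OF cl] scaleC_zero_left scaleC_one)
  show "cmod (l (G (x + h) - G x) - deriv ?g 0) \<le> 32 * M / \<rho>\<^sup>2 * (norm h)\<^sup>2" if "norm h \<le> \<rho> / 2"
    using ne z that
    by (cases "h = 0") (auto simp: clinear_diff[OF cl] clinear_zero[OF cl] scaleC_zero_left scaleC_one power_divide)
qed

lemma bounded_weakly_holomorphic_lipschitz:
  assumes N: "norming N"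
    and wh: "weakly_holomorphic N G (ball x \<rho>)" and \<rho>: "\<rho> > 0"
    and bd: "\<And>y. y \<in> ball x \<rho> \<Longrightarrow> norm (G y) \<le> M"
    and h: "norm h \<le> \<rho> / 2"
  shows "norm (G (x + h) - G x) \<le> 4 * M / \<rho> * norm h"
proof (rule norming_le[OF N])
  have "0 \<le> M" using bd[of x] norm_ge_zero[of "G x"] \<rho> by (simp del: norm_ge_zero)
  then show "0 \<le> 4 * M / \<rho> * norm h" using \<rho> by simp
  show "cmod (l (G (x + h) - G x)) \<le> 4 * M / \<rho> * norm h" if "l \<in> N" for l
    using directional_lipschitz[OF _ wh \<rho> bd that h] N by (auto simp: norming_def)
qed

text \<open>Apply the Lipschitz bound twice: the increment \<open>y \<mapsto> G (y + k) - G y\<close> is again weakly holomorphic,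
  and it is bounded by a multiple of \<open>\<parallel>k\<parallel>\<close>.\<close>

lemma bounded_weakly_holomorphic_second_difference:
  assumes N: "norming N"
    and wh: "weakly_holomorphic N G (ball x \<rho>)" and \<rho>: "\<rho> > 0"
    and bd: "\<And>y. y \<in> ball x \<rho> \<Longrightarrow> norm (G y) \<le> M"
    and h: "norm h \<le> \<rho> / 4" and k: "norm k \<le> \<rho> / 4"
  shows "norm (G (x + h + k) - G (x + h) - (G (x + k) - G x)) \<le> 64 * M / \<rho>\<^sup>2 * norm h * norm k"
proof -
  define u where "u y = G (y + k) - G y" for y
  note sub = ball_half_subset[of _ x \<rho>]
  have kin: "y + k \<in> ball x \<rho>" if "y \<in> ball x (\<rho> / 2)" for y
    using sub[OF that] k \<rho> by (auto simp: subset_iff dist_norm)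
  have "weakly_holomorphic N u (ball x (\<rho> / 2))"
    unfolding weakly_holomorphic_def
  proof (intro ballI allI)
    fix l y h assume l: "l \<in> N" and y: "y \<in> ball x (\<rho> / 2)"
    have "(\<lambda>\<zeta>. l (G ((y + k) + \<zeta> *\<^sub>C h)) - l (G (y + \<zeta> *\<^sub>C h))) field_differentiable (at 0)"
      using wh l kin[OF y] y \<rho> by (intro derivative_intros) (auto simp: weakly_holomorphic_def)
    moreover have "clinear l" using l N by (auto simp: norming_def dual_ball_def)
    ultimately show "(\<lambda>\<zeta>. l (u (y + \<zeta> *\<^sub>C h))) field_differentiable (at 0)"
      by (simp add: u_def clinear_diff add_ac)
  qed
  moreover have "norm (u y) \<le> 4 * M / (\<rho> / 2) * norm k" if "y \<in> ball x (\<rho> / 2)" for y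
    unfolding u_def
    by (rule bounded_weakly_holomorphic_lipschitz[OF N weakly_holomorphic_subset[OF wh sub[OF that]]])
      (use k \<rho> bd sub[OF that] in auto)
  ultimately have "norm (u (x + h) - u x) \<le> 4 * (4 * M / (\<rho> / 2) * norm k) / (\<rho> / 2) * norm h"
    by (intro bounded_weakly_holomorphic_lipschitz[OF N]) (use h \<rho> in auto)
  then show ?thesis by (simp add: u_def power2_eq_square field_simps)
qed

text \<open>The scalar Taylor estimate shows that the difference quotients \<open>t (G (x + h / t) - G x)\<close> are Cauchy
  at a rate independent of \<open>l\<close>, so they converge by completeness.\<close>

lemma directional_derivative_exists:
  fixes G :: "'a::complex_normed_vector \<Rightarrow> 'b::complex_banach"
  assumes N: "norming N"
    and wh: "weakly_holomorphic N G (ball x \<rho>)" and \<rho>: "\<rho> > 0"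
    and bd: "\<And>y. y \<in> ball x \<rho> \<Longrightarrow> norm (G y) \<le> M"
  shows "\<exists>b. \<forall>l\<in>N. l b = deriv (\<lambda>\<zeta>. l (G (x + \<zeta> *\<^sub>C h))) 0"
proof -
  define K where "K = 32 * M / \<rho>\<^sup>2 * (norm h)\<^sup>2"
  have "0 \<le> M" using bd[of x] norm_ge_zero[of "G x"] \<rho> by (simp del: norm_ge_zero)
  then have K: "K \<ge> 0" by (simp add: K_def)
  \<comment> \<open>\<open>n0\<close> is large enough to keep \<open>h / t n\<close> in the ball where the Taylor estimate holds\<close>
  obtain n0 :: nat where n0: "2 * norm h / \<rho> < n0" using reals_Archimedean2 by blast
  define t where "t n = real (n + n0 + 1)" for n
  have t: "t n > 0" "norm h \<le> t n * \<rho> / 2" for n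
    using n0 \<rho> by (auto simp: t_def field_simps) (smt (verit) mult_nonneg_nonneg of_nat_0_le_iff)
  define q where "q n = t n *\<^sub>R (G (x + (1 / t n) *\<^sub>R h) - G x)" for n
  have est: "cmod (l (q n) - deriv (\<lambda>\<zeta>. l (G (x + \<zeta> *\<^sub>C h))) 0) \<le> K / t n" if l: "l \<in> N" for l n
  proof -
    let ?d = "deriv (\<lambda>\<zeta>. l (G (x + \<zeta> *\<^sub>C h))) 0" and ?k = "(1 / t n) *\<^sub>R h"
    have cl: "clinear l" using l N by (auto simp: norming_def dual_ball_def)
    have dk: "deriv (\<lambda>\<zeta>. l (G (x + \<zeta> *\<^sub>C ?k))) 0 = of_real (1 / t n) * ?d"
      unfolding scaleR_scaleC by (rule directional_deriv_scale[OF wh l]) (use \<rho> in simp)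
    have "norm ?k \<le> \<rho> / 2" using t[of n] by (simp add: field_simps)
    from directional_taylor[OF _ wh \<rho> bd l this] N
    have "cmod (l (G (x + ?k) - G x) - of_real (1 / t n) * ?d) \<le> 32 * M / \<rho>\<^sup>2 * (norm ?k)\<^sup>2"
      unfolding dk by (auto simp: norming_def)
    also have "\<dots> = K / (t n)\<^sup>2" using t[of n] by (simp add: K_def power_divide)
    finally have "t n * cmod (l (G (x + ?k) - G x) - of_real (1 / t n) * ?d) \<le> t n * (K / (t n)\<^sup>2)"
      using t[of n] by (intro mult_left_mono) auto
    moreover have "l (q n) - ?d = of_real (t n) * (l (G (x + ?k) - G x) - of_real (1 / t n) * ?d)"
      using t[of n] clinear_scaleC[OF cl, of "of_real (t n)"]
      by (simp add: q_def scaleR_scaleC scaleC_complex_def right_diff_distrib)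
    ultimately show ?thesis using t[of n] by (simp add: norm_mult power2_eq_square)
  qed
  have tlim: "(\<lambda>n. K / t n) \<longlonglongrightarrow> 0"
    unfolding t_def by (rule divide_nat_shift_tendsto_zero)
  have "Cauchy q"
  proof (rule metric_CauchyI)
    fix e :: real assume "e > 0"
    with tlim have "\<forall>\<^sub>F n in sequentially. K / t n < e / 2" 
      by (intro order_tendstoD(2)[OF tlim]) auto
    then obtain m where m: "\<And>n. n \<ge> m \<Longrightarrow> K / t n < e / 2" by (auto simp: eventually_sequentially)
    have "dist (q i) (q j) < e" if ij: "i \<ge> m" "j \<ge> m" for i j
    proof -
      have "norm (q i - q j) \<le> K / t i + K / t j"
      proof (rule norming_le[OF N])
        show "0 \<le> K / t i + K / t j" using K t[of i] t[of j] by simp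
        fix l assume l: "l \<in> N"
        then have "clinear l" using N by (auto simp: norming_def dual_ball_def)
        then show "cmod (l (q i - q j)) \<le> K / t i + K / t j"
          using est[OF l, of i] est[OF l, of j] 
            norm_triangle_ineq4[of "l (q i) - deriv (\<lambda>\<zeta>. l (G (x + \<zeta> *\<^sub>C h))) 0" "l (q j) - deriv (\<lambda>\<zeta>. l (G (x + \<zeta> *\<^sub>C h))) 0"]
          by (simp add: clinear_diff)
      qed
      then show ?thesis using m[OF ij(1)] m[OF ij(2)] unfolding dist_norm by linarith
    qed
    then show "\<exists>m. \<forall>i\<ge>m. \<forall>j\<ge>m. dist (q i) (q j) < e" by blast
  qed
  then obtain b where b: "q \<longlonglongrightarrow> b" using Cauchy_convergent_iff convergent_def by blast
  have "l b = deriv (\<lambda>\<zeta>. l (G (x + \<zeta> *\<^sub>C h))) 0" if l: "l \<in> N" for l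
  proof (rule LIMSEQ_unique)
    have "bounded_linear l" using l N by (auto simp: norming_def intro: bounded_linear_dual_ball)
    then show "(\<lambda>n. l (q n)) \<longlonglongrightarrow> l b" by (rule bounded_linear.tendsto[OF _ b])
    show "(\<lambda>n. l (q n)) \<longlonglongrightarrow> deriv (\<lambda>\<zeta>. l (G (x + \<zeta> *\<^sub>C h))) 0"
      by (rule LIM_zero_cancel, rule Lim_null_comparison[OF _ tlim]) (use est[OF l] in auto)
  qed
  then show ?thesis by blast
qed

text \<open>The directional derivatives \<open>B h\<close> are complex homogeneous, and Taylor's formula has a
  remainder of order \<open>\<parallel>h\<parallel>\<^sup>2\<close>, uniformly in the direction.  Only additivity of \<open>B\<close> needs an argument: by
  homogeneity, \<open>t (B (h + k) - B h - B k)\<close> is a second difference of \<open>G\<close> up to Taylor remainders, hence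
  of order \<open>t\<^sup>2\<close>.\<close>

lemma bounded_weakly_holomorphic_imp_differentiable:
  fixes G :: "'a::complex_normed_vector \<Rightarrow> 'b::complex_banach"
  assumes N: "norming N"
    and wh: "weakly_holomorphic N G (ball x \<rho>)" and \<rho>: "\<rho> > 0"
    and bd: "\<And>y. y \<in> ball x \<rho> \<Longrightarrow> norm (G y) \<le> M"
  shows "\<exists>B. (G has_derivative B) (at x) \<and> clinear B"
proof -
  have M: "0 \<le> M" using bd[of x] norm_ge_zero[of "G x"] \<rho> by (simp del: norm_ge_zero)
  have ND: "N \<subseteq> dual_ball" using N by (simp add: norming_def)
  obtain B where B: "\<And>l h. l \<in> N \<Longrightarrow> l (B h) = deriv (\<lambda>\<zeta>. l (G (x + \<zeta> *\<^sub>C h))) 0"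
    using directional_derivative_exists[OF N wh \<rho> bd] by metis
  define K where "K = 32 * M / \<rho>\<^sup>2"
  have K: "K \<ge> 0" using M by (simp add: K_def)
  have cl: "clinear l" if "l \<in> N" for l using that ND by (auto simp: dual_ball_def)
  have x: "x \<in> ball x \<rho>" using \<rho> by simp
  have bound: "norm (B h) \<le> 4 * M / \<rho> * norm h" for h
    by (rule norming_le[OF N])
      (use directional_deriv_bound[OF ND wh \<rho> bd] M \<rho> in \<open>auto simp: B\<close>)
  have taylor: "norm (G (x + h) - G x - B h) \<le> K * (norm h)\<^sup>2" if "norm h \<le> \<rho> / 2" for h
    by (rule norming_le[OF N])
      (use directional_taylor[OF ND wh \<rho> bd _ that] M in \<open>auto simp: B K_def clinear_diff[OF cl]\<close>)
  have sep: "a = b" if "\<And>l. l \<in> N \<Longrightarrow> l a = l b" for a b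
    using norming_le[OF N, of 0 "a - b"] that by (auto simp: clinear_diff[OF cl])
  have scale: "B (c *\<^sub>C h) = c *\<^sub>C B h" for c h
    by (rule sep) (simp add: B clinear_scaleC[OF cl] scaleC_complex_def directional_deriv_scale[OF wh _ x])
  have scaleR: "B (c *\<^sub>R h) = c *\<^sub>R B h" for c h by (simp add: scaleR_scaleC scale)
  have add: "B (h + k) = B h + B k" for h k
  proof -
    define C where "C = 64 * M / \<rho>\<^sup>2 * norm h * norm k + K * (norm (h + k))\<^sup>2 + K * (norm h)\<^sup>2 + K * (norm k)\<^sup>2"
    define d where "d = B (h + k) - B h - B k"
    have "norm d \<le> t * C" if t: "0 < t" "t < \<rho> / 4 / (norm h + norm k + 1)" for t
    proof -
      have pos: "0 < norm h + norm k + 1" by (simp add: add_nonneg_pos)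
      have "t * (norm h + norm k + 1) < \<rho> / 4"
        using t(2) by (simp only: pos_less_divide_eq[OF pos])
      then have "t * norm h + t * norm k \<le> \<rho> / 4" using t by (simp add: algebra_simps)
      then have th: "norm (t *\<^sub>R h) \<le> \<rho> / 4" "norm (t *\<^sub>R k) \<le> \<rho> / 4"
        and tk: "norm (t *\<^sub>R h) \<le> \<rho> / 2" "norm (t *\<^sub>R k) \<le> \<rho> / 2" "norm (t *\<^sub>R h + t *\<^sub>R k) \<le> \<rho> / 2"
      proof -
        have n: "norm (t *\<^sub>R h) = t * norm h" "norm (t *\<^sub>R k) = t * norm k" using t by simp_all
        have "0 \<le> t * norm h" "0 \<le> t * norm k" using t by simp_all
        then show "norm (t *\<^sub>R h) \<le> \<rho> / 4" "norm (t *\<^sub>R k) \<le> \<rho> / 4"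
          "norm (t *\<^sub>R h) \<le> \<rho> / 2" "norm (t *\<^sub>R k) \<le> \<rho> / 2" "norm (t *\<^sub>R h + t *\<^sub>R k) \<le> \<rho> / 2"
          using norm_triangle_ineq[of "t *\<^sub>R h" "t *\<^sub>R k"] \<rho> \<open>t * norm h + t * norm k \<le> \<rho> / 4\<close>
          unfolding n by linarith+
      qed
      have sd: "norm (G (x + t *\<^sub>R h + t *\<^sub>R k) - G (x + t *\<^sub>R h) - (G (x + t *\<^sub>R k) - G x))
          \<le> t\<^sup>2 * (64 * M / \<rho>\<^sup>2 * norm h * norm k)"
        using bounded_weakly_holomorphic_second_difference[OF N wh \<rho> bd th] t
        by (simp add: power2_eq_square mult_ac)
      have t1: "norm (G (x + t *\<^sub>R h) - G x - B (t *\<^sub>R h)) \<le> t\<^sup>2 * (K * (norm h)\<^sup>2)"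
        and t2: "norm (G (x + t *\<^sub>R k) - G x - B (t *\<^sub>R k)) \<le> t\<^sup>2 * (K * (norm k)\<^sup>2)"
        using taylor[OF tk(1)] taylor[OF tk(2)] by (simp_all add: power_mult_distrib mult_ac)
      have "t *\<^sub>R h + t *\<^sub>R k = t *\<^sub>R (h + k)" by (simp add: algebra_simps)
      then have t3: "norm (G (x + t *\<^sub>R h + t *\<^sub>R k) - G x - B (t *\<^sub>R (h + k))) \<le> t\<^sup>2 * (K * (norm (h + k))\<^sup>2)"
        using taylor[OF tk(3)] by (simp add: power_mult_distrib mult_ac add.assoc)
      have "t *\<^sub>R d = (G (x + t *\<^sub>R h + t *\<^sub>R k) - G (x + t *\<^sub>R h) - (G (x + t *\<^sub>R k) - G x))
          - (G (x + t *\<^sub>R h + t *\<^sub>R k) - G x - B (t *\<^sub>R (h + k)))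
          + (G (x + t *\<^sub>R h) - G x - B (t *\<^sub>R h)) + (G (x + t *\<^sub>R k) - G x - B (t *\<^sub>R k))" (is "_ = ?a - ?b + ?c + ?e")
        unfolding d_def scaleR by (simp add: algebra_simps)
      then have "norm (t *\<^sub>R d) \<le> norm ?a + norm ?b + norm ?c + norm ?e"
        by (metis (no_types, lifting) add_mono norm_triangle_ineq norm_triangle_ineq4 norm_triangle_le order_refl)
      then have "norm (t *\<^sub>R d) \<le> t\<^sup>2 * C"
        using sd t1 t2 t3 by (simp add: C_def distrib_left)
      then show ?thesis using t by (simp add: power2_eq_square)
    qed
    note small = this
    have "0 < \<rho> / 4 / (norm h + norm k + 1)"
      using \<rho> by (intro divide_pos_pos add_nonneg_pos add_nonneg_nonneg) auto
    from eventually_at_right_real[OF this] have "\<forall>\<^sub>F t in at_right 0. norm d \<le> t * C"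
      by (rule eventually_mono) (use small in \<open>simp only: greaterThanLessThan_iff\<close>)
    moreover have "((\<lambda>t. t * C) \<longlongrightarrow> 0 * C) (at_right 0)" by (intro tendsto_intros)
    ultimately have "norm d \<le> 0 * C"
      by (intro tendsto_lowerbound[of "\<lambda>t. t * C" _ "at_right 0"]) auto
    then show ?thesis by (simp add: d_def algebra_simps)
  qed
  have bl: "bounded_linear B"
    by (rule bounded_linear_intro[where K = "4 * M / \<rho>"]) (use add scaleR bound in \<open>auto simp: mult.commute\<close>)
  have "(G has_derivative B) (at x)"
    unfolding has_derivative_at
  proof (intro conjI bl)
    show "(\<lambda>h. norm (G (x + h) - G x - B h) / norm h) \<midarrow>0\<rightarrow> 0"
    proof (rule tendsto_sandwich[of "\<lambda>_. 0" _ _ "\<lambda>h. K * norm h"])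
      have "\<forall>\<^sub>F h in at (0::'a). norm h < \<rho> / 2" and "\<forall>\<^sub>F h in at (0::'a). h \<noteq> 0"
        using \<rho> by (auto simp: eventually_at dist_norm intro!: exI[of _ "\<rho> / 2"])
      then show "\<forall>\<^sub>F h in at 0. norm (G (x + h) - G x - B h) / norm h \<le> K * norm h"
      proof eventually_elim
        case (elim h)
        then show ?case using taylor[of h] by (simp add: field_simps power2_eq_square)
      qed
      have "((\<lambda>h::'a. K * norm h) \<longlongrightarrow> K * norm (0::'a)) (at 0)" by (intro tendsto_intros)
      then show "((\<lambda>h::'a. K * norm h) \<longlongrightarrow> 0) (at 0)" by simp
    qed auto
  qed
  then show ?thesis using bounded_linear.linear[OF bl] scale by (auto simp: clinear_def)
qed


lemma Cholomorphic_on_locally_bounded: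
  assumes hol: "F Cholomorphic_on S" and S: "open S" and x: "x \<in> S"
  obtains \<rho> M where "\<rho> > 0" "ball x \<rho> \<subseteq> S" "\<And>y. y \<in> ball x \<rho> \<Longrightarrow> norm (F y) \<le> M"
proof -
  obtain D where "(F has_derivative D) (at x)" using hol x by (auto simp: Cholomorphic_on_def)
  then have "isCont F x" by (rule has_derivative_continuous)
  then obtain d where d: "d > 0" "\<And>y. dist y x < d \<Longrightarrow> dist (F y) (F x) < 1"
    by (metis continuous_at_eps_delta zero_less_one)
  obtain r where r: "r > 0" "ball x r \<subseteq> S" using S x by (meson openE)
  show thesis
  proof (rule that[of "min d r" "norm (F x) + 1"])
    show "norm (F y) \<le> norm (F x) + 1" if "y \<in> ball x (min d r)" for y
      using d(2)[of y] that norm_triangle_sub[of "F y" "F x"] by (simp add: dist_commute dist_norm norm_minus_commute)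
  qed (use d r in auto)
qed

lemma fderiv_apply:
  assumes "(F has_derivative D) (at z)" shows "blinfun_apply (fderiv F z) = D"
  using assms bounded_linear_Blinfun_apply[OF has_derivative_bounded_linear[OF assms]]
  by (simp add: fderiv_def frechet_derivative_at[symmetric])

lemma Cholomorphic_on_fderiv:
  assumes "F Cholomorphic_on S" "z \<in> S"
  shows "(F has_derivative blinfun_apply (fderiv F z)) (at z)" "clinear (blinfun_apply (fderiv F z))"
  using assms fderiv_apply by (force simp: Cholomorphic_on_def)+

lemma has_field_derivative_along_line:
  fixes F :: "'a::complex_normed_vector \<Rightarrow> 'b::complex_normed_vector"
  assumes hol: "F Cholomorphic_on S" and z: "x + \<zeta> *\<^sub>C h \<in> S"
    and l: "bounded_linear l" "clinear l"
  shows "((\<lambda>\<zeta>. l (F (x + \<zeta> *\<^sub>C h))) has_field_derivative l (blinfun_apply (fderiv F (x + \<zeta> *\<^sub>C h)) h)) (at \<zeta>)"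
proof -
  let ?D = "blinfun_apply (fderiv F (x + \<zeta> *\<^sub>C h))"
  have line: "((\<lambda>\<zeta>. x + \<zeta> *\<^sub>C h) has_derivative (\<lambda>\<eta>. \<eta> *\<^sub>C h)) (at \<zeta>)"
    by (auto intro!: derivative_eq_intros 
        bounded_linear_imp_has_derivative bounded_bilinear.bounded_linear_left[OF bounded_bilinear_scaleC])
  have "((\<lambda>\<zeta>. l (F (x + \<zeta> *\<^sub>C h))) has_derivative (\<lambda>\<eta>. l (?D (\<eta> *\<^sub>C h)))) (at \<zeta>)"
    using has_derivative_compose[OF line Cholomorphic_on_fderiv(1)[OF hol z]]
    by (rule bounded_linear.has_derivative[OF l(1)])
  moreover have "(\<lambda>\<eta>. l (?D (\<eta> *\<^sub>C h))) = (*) (l (?D h))"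
    using clinear_scaleC[OF Cholomorphic_on_fderiv(2)[OF hol z]] clinear_scaleC[OF l(2)]
    by (simp add: fun_eq_iff scaleC_complex_def mult.commute)
  ultimately show ?thesis by (simp add: has_field_derivative_def)
qed

lemma directional_deriv_Cholomorphic:
  assumes hol: "F Cholomorphic_on S" and x: "x \<in> S" and l: "l \<in> dual_ball"
  shows "deriv (\<lambda>\<zeta>. l (F (x + \<zeta> *\<^sub>C h))) 0 = l (blinfun_apply (fderiv F x) h)"
  using has_field_derivative_along_line[OF hol, of x 0 h l] x l bounded_linear_dual_ball[OF l]
  by (intro DERIV_imp_deriv) (simp add: scaleC_zero_left dual_ball_def)

lemma Cholomorphic_on_imp_weakly_holomorphic:
  assumes hol: "F Cholomorphic_on S"
  shows "weakly_holomorphic dual_ball F S"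
  unfolding weakly_holomorphic_def
proof (intro ballI allI)
  fix l :: "'b \<Rightarrow> complex" and x h assume "l \<in> dual_ball" "x \<in> S"
  then show "(\<lambda>\<zeta>. l (F (x + \<zeta> *\<^sub>C h))) field_differentiable at 0"
    using has_field_derivative_along_line[OF hol, of x 0 h l] bounded_linear_dual_ball[of l]
    by (auto simp: scaleC_zero_left dual_ball_def field_differentiable_def)
qed

text \<open>For fixed \<open>v\<close>, the function \<open>\<zeta> \<mapsto> l (DF(x + \<zeta> h) v)\<close> is a uniform limit of the holomorphic
  difference quotients of \<open>F\<close> in the direction \<open>v\<close>.\<close>

lemma weakly_holomorphic_fderiv:
  fixes F :: "'a::complex_normed_vector \<Rightarrow> 'b::complex_normed_vector"
  assumes hol: "F Cholomorphic_on S" and S: "open S"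
  shows "weakly_holomorphic evaluation_functionals (fderiv F) S"
  unfolding weakly_holomorphic_def
proof (intro ballI allI)
  fix \<Lambda> :: "('a \<Rightarrow>\<^sub>L 'b) \<Rightarrow> complex" and x h :: 'a
  assume "\<Lambda> \<in> evaluation_functionals" and x: "x \<in> S"
  then obtain l v where L: "\<Lambda> = (\<lambda>A. l (blinfun_apply A v))" and l: "l \<in> dual_ball"
    by (auto simp: evaluation_functionals_def)
  have cl: "clinear l" using l by (simp add: dual_ball_def)
  obtain \<rho> M where \<rho>: "\<rho> > 0" and sub: "ball x \<rho> \<subseteq> S" and bd: "\<And>y. y \<in> ball x \<rho> \<Longrightarrow> norm (F y) \<le> M"
    using Cholomorphic_on_locally_bounded[OF hol S x] by blast
  have wh: "weakly_holomorphic dual_ball F (ball x \<rho>)"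
    by (rule weakly_holomorphic_subset[OF Cholomorphic_on_imp_weakly_holomorphic[OF hol] sub])
  define \<delta> where "\<delta> = \<rho> / 2 / (norm h + 1)"
  have \<delta>: "\<delta> > 0" using \<rho> by (simp add: \<delta>_def add_nonneg_pos)
  have near: "x + \<zeta> *\<^sub>C h \<in> ball x (\<rho> / 2)" if "\<zeta> \<in> ball 0 \<delta>" for \<zeta>
  proof -
    have pos: "0 < norm h + 1" by (simp add: add_nonneg_pos)
    have "cmod \<zeta> < \<rho> / 2 / (norm h + 1)" using that by (simp only: \<delta>_def mem_ball_0)
    then have less: "cmod \<zeta> * (norm h + 1) < \<rho> / 2" by (simp only: pos_less_divide_eq[OF pos])
    have "cmod \<zeta> * norm h \<le> cmod \<zeta> * (norm h + 1)" by (simp add: mult_left_mono)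
    also note less
    finally show ?thesis by (simp add: dist_norm norm_scaleC)
  qed
  obtain n0 :: nat where n0: "4 * norm v / \<rho> < n0" using reals_Archimedean2 by blast
  define t where "t n = real (n + n0 + 1)" for n
  have t0: "t n > 0" for n by (simp add: t_def)
  have t: "norm ((1 / t n) *\<^sub>R v) < \<rho> / 4" for n
  proof -
    have "4 * norm v < n0 * \<rho>" using n0 \<rho> by (simp add: pos_divide_less_eq)
    also have "\<dots> \<le> t n * \<rho>" using \<rho> by (simp add: t_def)
    finally show ?thesis using t0[of n] by (simp add: pos_divide_less_eq mult.commute)
  qed
  define f where "f n \<zeta> = of_real (t n) * (l (F ((x + (1 / t n) *\<^sub>R v) + \<zeta> *\<^sub>C h)) - l (F (x + \<zeta> *\<^sub>C h)))" for n \<zeta>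
  define K where "K = 32 * M / (\<rho> / 2)\<^sup>2 * (norm v)\<^sup>2"
  have est: "cmod (f n \<zeta> - \<Lambda> (fderiv F (x + \<zeta> *\<^sub>C h))) \<le> K / t n" if z: "\<zeta> \<in> ball 0 \<delta>" for n \<zeta>
  proof -
    let ?y = "x + \<zeta> *\<^sub>C h" and ?k = "(1 / t n) *\<^sub>R v"
    note sub' = ball_half_subset[OF near[OF z]]
    have y: "?y \<in> S" using near[OF z] \<rho> sub by auto
    have half: "\<rho> / 2 > 0" using \<rho> by simp
    have bd': "norm (F w) \<le> M" if "w \<in> ball ?y (\<rho> / 2)" for w using bd sub' that by blast
    have "norm ?k \<le> \<rho> / 2 / 2" using t[of n] by simp
    from directional_taylor[OF subset_refl weakly_holomorphic_subset[OF wh sub'] half bd' l this]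
    have "cmod (l (F (?y + ?k) - F ?y) - l (blinfun_apply (fderiv F ?y) ?k)) \<le> 32 * M / (\<rho> / 2)\<^sup>2 * (norm ?k)\<^sup>2"
      by (simp only: directional_deriv_Cholomorphic[OF hol y l])
    also have "\<dots> = K / (t n)\<^sup>2" using t0[of n] by (simp add: K_def power_divide)
    finally have "t n * cmod (l (F (?y + ?k) - F ?y) - l (blinfun_apply (fderiv F ?y) ?k)) \<le> t n * (K / (t n)\<^sup>2)"
      using t0[of n] by (intro mult_left_mono) auto
    moreover have "f n \<zeta> - \<Lambda> (fderiv F ?y) = of_real (t n) * (l (F (?y + ?k) - F ?y) - l (blinfun_apply (fderiv F ?y) ?k))"
    proof -
      have "l (blinfun_apply (fderiv F ?y) ?k) = of_real (1 / t n) * \<Lambda> (fderiv F ?y)"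
        using clinear_scaleC[OF cl, of "of_real (1 / t n)"]
        by (simp only: L blinfun.scaleR_right) (simp add: scaleR_scaleC scaleC_complex_def)
      moreover have "x + ?k + \<zeta> *\<^sub>C h = ?y + ?k" by (simp only: add_ac)
      then have "f n \<zeta> = of_real (t n) * (l (F (?y + ?k)) - l (F ?y))" by (simp only: f_def)
      ultimately show ?thesis
        using t0[of n] by (simp add: clinear_diff[OF cl] right_diff_distrib)
    qed
    ultimately show ?thesis using t0[of n] by (simp add: norm_mult power2_eq_square)
  qed
  have tlim: "(\<lambda>n. K / t n) \<longlonglongrightarrow> 0"
    unfolding t_def by (rule divide_nat_shift_tendsto_zero)
  have "(\<lambda>\<zeta>. \<Lambda> (fderiv F (x + \<zeta> *\<^sub>C h))) holomorphic_on ball 0 \<delta>"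
  proof (rule holomorphic_uniform_sequence[where f = f])
    show "f n holomorphic_on ball 0 \<delta>" for n
      unfolding f_def
    proof (intro holomorphic_intros weakly_holomorphic_on_line[OF wh l])
      fix \<zeta> :: complex assume z: "\<zeta> \<in> ball 0 \<delta>"
      have s: "ball (x + \<zeta> *\<^sub>C h) (\<rho> / 2) \<subseteq> ball x \<rho>" by (rule ball_half_subset[OF near[OF z]])
      show "x + \<zeta> *\<^sub>C h \<in> ball x \<rho>" using near[OF z] \<rho> by auto
      have "x + \<zeta> *\<^sub>C h + (1 / t n) *\<^sub>R v \<in> ball (x + \<zeta> *\<^sub>C h) (\<rho> / 2)"
      proof -
        have "norm ((1 / t n) *\<^sub>R v) < \<rho> / 2" using t[of n] \<rho> by linarith
        then show ?thesis by (simp add: dist_norm)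
      qed
      then show "x + (1 / t n) *\<^sub>R v + \<zeta> *\<^sub>C h \<in> ball x \<rho>"
        using subsetD[OF s] by (simp only: add_ac)
    qed
    fix \<zeta>0 :: complex assume "\<zeta>0 \<in> ball 0 \<delta>"
    then obtain d where d: "d > 0" "cball \<zeta>0 d \<subseteq> ball 0 \<delta>" by (meson open_ball open_contains_cball)
    have "uniform_limit (cball \<zeta>0 d) f (\<lambda>\<zeta>. \<Lambda> (fderiv F (x + \<zeta> *\<^sub>C h))) sequentially"
    proof (rule uniform_limitI)
      fix e :: real assume "e > 0"
      then have "\<forall>\<^sub>F n in sequentially. K / t n < e" by (rule order_tendstoD(2)[OF tlim])
      then show "\<forall>\<^sub>F n in sequentially. \<forall>\<zeta>\<in>cball \<zeta>0 d. dist (f n \<zeta>) (\<Lambda> (fderiv F (x + \<zeta> *\<^sub>C h))) < e"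
      proof eventually_elim
        case (elim n)
        show ?case
        proof
          fix \<zeta> assume "\<zeta> \<in> cball \<zeta>0 d"
          then have "\<zeta> \<in> ball 0 \<delta>" using d(2) by blast
          from est[OF this, of n] elim
          show "dist (f n \<zeta>) (\<Lambda> (fderiv F (x + \<zeta> *\<^sub>C h))) < e" unfolding dist_norm by linarith
        qed
      qed
    qed
    then show "\<exists>d. 0 < d \<and> cball \<zeta>0 d \<subseteq> ball 0 \<delta> \<and>
        uniform_limit (cball \<zeta>0 d) f (\<lambda>\<zeta>. \<Lambda> (fderiv F (x + \<zeta> *\<^sub>C h))) sequentially"
      using d by blast
  qed simp
  then show "(\<lambda>\<zeta>. \<Lambda> (fderiv F (x + \<zeta> *\<^sub>C h))) field_differentiable at 0"
    using \<delta> by (rule_tac holomorphic_on_imp_differentiable_at[of _ "ball 0 \<delta>"]) auto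
qed

text \<open>Cauchy's inequality makes \<open>fderiv F\<close> locally bounded, so the criterion for bounded weakly
  holomorphic mappings applies, with the evaluation functionals as norming set.\<close>

theorem Cholomorphic_fderiv:
  fixes F :: "'a::complex_normed_vector \<Rightarrow> 'b::complex_banach"
  assumes hol: "F Cholomorphic_on S" and S: "open S"
  shows "fderiv F Cholomorphic_on S"
  unfolding Cholomorphic_on_def
proof
  fix x assume x: "x \<in> S"
  obtain \<rho> M where \<rho>: "\<rho> > 0" and sub: "ball x \<rho> \<subseteq> S" and bd: "\<And>y. y \<in> ball x \<rho> \<Longrightarrow> norm (F y) \<le> M"
    using Cholomorphic_on_locally_bounded[OF hol S x] by blast
  have M: "0 \<le> M" using bd[of x] norm_ge_zero[of "F x"] \<rho> by (simp del: norm_ge_zero)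
  have wh: "weakly_holomorphic dual_ball F (ball x \<rho>)"
    by (rule weakly_holomorphic_subset[OF Cholomorphic_on_imp_weakly_holomorphic[OF hol] sub])
  have bd2: "norm (fderiv F y) \<le> 4 * M / (\<rho> / 2)" if y: "y \<in> ball x (\<rho> / 2)" for y
  proof (rule norm_blinfun_bound)
    note sub' = ball_half_subset[OF y]
    have yS: "y \<in> S" using y \<rho> sub by auto
    have half: "\<rho> / 2 > 0" using \<rho> by simp
    have bd': "norm (F w) \<le> M" if "w \<in> ball y (\<rho> / 2)" for w using bd sub' that by blast
    show "norm (blinfun_apply (fderiv F y) v) \<le> 4 * M / (\<rho> / 2) * norm v" for v
    proof (rule norming_le[OF norming_dual_ball])
      fix l :: "'b \<Rightarrow> complex" assume l: "l \<in> dual_ball"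
      show "cmod (l (blinfun_apply (fderiv F y) v)) \<le> 4 * M / (\<rho> / 2) * norm v"
        using directional_deriv_bound[OF subset_refl weakly_holomorphic_subset[OF wh sub'] half bd' l, of v]
        by (simp only: directional_deriv_Cholomorphic[OF hol yS l])
    qed (use M \<rho> in auto)
  qed (use M \<rho> in auto)
  have "weakly_holomorphic evaluation_functionals (fderiv F) (ball x (\<rho> / 2))"
    by (rule weakly_holomorphic_subset[OF weakly_holomorphic_fderiv[OF hol S]]) (use sub \<rho> in auto)
  from bounded_weakly_holomorphic_imp_differentiable[OF norming_evaluation_functionals this _ bd2]
  show "\<exists>D. (fderiv F has_derivative D) (at x) \<and> clinear D" using \<rho> by simp
qed

lemma higher_deriv_Suc_if_DERIV:
  assumes "\<And>\<zeta>. \<zeta> \<in> ball 0 1 \<Longrightarrow> (f has_field_derivative f' \<zeta>) (at \<zeta>)"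
  shows "(deriv ^^ Suc n) f 0 = (deriv ^^ n) f' (0::complex)"
proof -
  have "\<forall>\<^sub>F \<zeta> in nhds 0. \<zeta> \<in> ball (0::complex) 1" by (rule eventually_nhds_in_open) auto
  then have "\<forall>\<^sub>F \<zeta> in nhds 0. deriv f \<zeta> = f' \<zeta>"
    by eventually_elim (use assms DERIV_imp_deriv in blast)
  then show ?thesis unfolding funpow_Suc_right o_def by (rule higher_deriv_cong_ev) simp
qed

text \<open>One step of the chain rule along the line through \<open>u\<close>.  The functional \<open>A \<mapsto> l (A v)\<close> satisfies the
  same hypotheses as \<open>l\<close>, so the step can be repeated with \<open>fderiv F\<close> in place of \<open>F\<close>.\<close>

lemma higher_deriv_along_line:
  fixes F :: "'a::complex_normed_vector \<Rightarrow> 'b::complex_banach"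
  assumes hol: "F Cholomorphic_on ball 0 1" and u: "norm u = 1" and l: "bounded_linear l" "clinear l"
  shows "(deriv ^^ Suc n) (\<lambda>\<zeta>. l (F (\<zeta> *\<^sub>C u))) 0 = (deriv ^^ n) (\<lambda>\<zeta>. l (blinfun_apply (fderiv F (\<zeta> *\<^sub>C u)) u)) 0"
    and "bounded_linear (\<lambda>A. l (blinfun_apply A v))" and "clinear (\<lambda>A. l (blinfun_apply A v))"
proof -
  show "(deriv ^^ Suc n) (\<lambda>\<zeta>. l (F (\<zeta> *\<^sub>C u))) 0 = (deriv ^^ n) (\<lambda>\<zeta>. l (blinfun_apply (fderiv F (\<zeta> *\<^sub>C u)) u)) 0"
  proof (rule higher_deriv_Suc_if_DERIV)
    fix \<zeta> :: complex assume "\<zeta> \<in> ball 0 1"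
    then show "((\<lambda>\<zeta>. l (F (\<zeta> *\<^sub>C u))) has_field_derivative l (blinfun_apply (fderiv F (\<zeta> *\<^sub>C u)) u)) (at \<zeta>)"
      using has_field_derivative_along_line[OF hol _ l, of 0 \<zeta> u] u by (simp add: norm_scaleC)
  qed
  show bl: "bounded_linear (\<lambda>A. l (blinfun_apply A v))"
    by (rule bounded_linear_compose[OF l(1) blinfun.bounded_linear_left])
  show "clinear (\<lambda>A. l (blinfun_apply A v))"
    using bounded_linear.linear[OF bl] l(2) by (simp add: clinear_def scaleC_blinfun_apply)
qed

lemma coeffs_eq_higher_deriv:
  fixes F :: "'a::complex_banach \<Rightarrow> 'a"
  assumes hol: "F Cholomorphic_on ball 0 1" and z: "z \<noteq> 0" and l: "clinear (blinfun_apply l)"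
  defines "h \<equiv> \<lambda>\<zeta>. blinfun_apply l (F (\<zeta> *\<^sub>C (z /\<^sub>R norm z)))"
  shows "coeff2 F z l = (deriv ^^ 2) h 0 / fact 2"
    and "coeff3 F z l = (deriv ^^ 3) h 0 / fact 3"
    and "coeff4 F z l = (deriv ^^ 4) h 0 / fact 4"
proof -
  define u where "u = z /\<^sub>R norm z"
  have u: "norm u = 1" and zu: "z = norm z *\<^sub>R u" using z by (simp_all add: u_def)
  note H1 = Cholomorphic_fderiv[OF hol open_ball]
  note H2 = Cholomorphic_fderiv[OF H1 open_ball]
  note H3 = Cholomorphic_fderiv[OF H2 open_ball]
  note l0 = blinfun.bounded_linear_right[of l] l
  note l1 = higher_deriv_along_line(2,3)[OF hol u l0, of u]
  note l2 = higher_deriv_along_line(2,3)[OF H1 u l1, of u]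
  note l3 = higher_deriv_along_line(2,3)[OF H2 u l2, of u]
  note step = higher_deriv_along_line(1)[OF hol u l0] higher_deriv_along_line(1)[OF H1 u l1]
    higher_deriv_along_line(1)[OF H2 u l2] higher_deriv_along_line(1)[OF H3 u l3]
  have h: "h = (\<lambda>\<zeta>. blinfun_apply l (F (\<zeta> *\<^sub>C u)))" by (simp add: h_def u_def)
  have "(deriv ^^ Suc (Suc 0)) h 0 = blinfun_apply l (blinfun_apply (blinfun_apply (fderiv (fderiv F) 0) u) u)"
    "(deriv ^^ Suc (Suc (Suc 0))) h 0 = blinfun_apply l
      (blinfun_apply (blinfun_apply (blinfun_apply (fderiv (fderiv (fderiv F)) 0) u) u) u)"
    "(deriv ^^ Suc (Suc (Suc (Suc 0)))) h 0 = blinfun_apply l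
      (blinfun_apply (blinfun_apply (blinfun_apply (blinfun_apply
        (fderiv (fderiv (fderiv (fderiv F))) 0) u) u) u) u)"
    unfolding h step by (simp_all only: funpow_0 scaleC_zero_left)
  note d = this
  have "blinfun_apply l (blinfun_apply (blinfun_apply (fderiv (fderiv F) 0) z) z)
      = of_real (norm z ^ 2) * (deriv ^^ 2) h 0"
    unfolding numeral_2_eq_2 d
    by (subst (1 2) zu) (simp add: blinfun.scaleR_right blinfun.scaleR_left scaleR_conv_of_real)
  then show "coeff2 F z l = (deriv ^^ 2) h 0 / fact 2"
    unfolding coeff2_def using z by simp
  have "blinfun_apply l (blinfun_apply (blinfun_apply (blinfun_apply (fderiv (fderiv (fderiv F)) 0) z) z) z)
      = of_real (norm z ^ 3) * (deriv ^^ 3) h 0"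
    unfolding numeral_3_eq_3 d
    by (subst (1 2 3) zu) (simp add: blinfun.scaleR_right blinfun.scaleR_left scaleR_conv_of_real)
  then show "coeff3 F z l = (deriv ^^ 3) h 0 / fact 3"
    unfolding coeff3_def using z by simp
  have four: "4 = Suc (Suc (Suc (Suc 0)))" by simp
  have "blinfun_apply l (blinfun_apply (blinfun_apply (blinfun_apply (blinfun_apply
        (fderiv (fderiv (fderiv (fderiv F))) 0) z) z) z) z) = of_real (norm z ^ 4) * (deriv ^^ 4) h 0"
    unfolding four d
    by (subst (1 2 3 4) zu) (simp add: blinfun.scaleR_right blinfun.scaleR_left scaleR_conv_of_real)
  then show "coeff4 F z l = (deriv ^^ 4) h 0 / fact 4"
    unfolding coeff4_def using z by simp
qed

section \<open>Starlike mappings of the form f(z) z\<close>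

lemma support_functionals_scaleC:
  assumes l: "l \<in> support_functionals u" and u: "norm u = 1" and \<zeta>: "\<zeta> \<noteq> 0"
  shows "(of_real (cmod \<zeta>) / \<zeta>) *\<^sub>C l \<in> support_functionals (\<zeta> *\<^sub>C u)"
proof -
  let ?c = "of_real (cmod \<zeta>) / \<zeta>"
  have cl: "clinear (blinfun_apply l)" and lu: "blinfun_apply l u = 1" and nl: "norm l = 1"
    using l u by (auto simp: support_functionals_def)
  have "clinear (blinfun_apply (?c *\<^sub>C l))"
    unfolding clinear_def
  proof (intro conjI allI)
    show "linear (blinfun_apply (?c *\<^sub>C l))"
      by (rule bounded_linear.linear[OF blinfun.bounded_linear_right])
  qed (simp add: scaleC_blinfun_apply clinear_scaleC[OF cl] scaleC_complex_def)
  moreover have "blinfun_apply (?c *\<^sub>C l) (\<zeta> *\<^sub>C u) = of_real (norm (\<zeta> *\<^sub>C u))"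
    using \<zeta> by (simp add: scaleC_blinfun_apply clinear_scaleC[OF cl] scaleC_complex_def lu norm_scaleC u)
  moreover have "norm (?c *\<^sub>C l) = 1" using \<zeta> by (simp add: norm_scaleC nl norm_divide)
  ultimately show ?thesis by (simp add: support_functionals_def)
qed

lemma support_functionals_normalize:
  assumes l: "l \<in> support_functionals z" and z: "z \<noteq> 0"
  shows "l \<in> support_functionals (z /\<^sub>R norm z)"
  using l z by (simp add: support_functionals_def blinfun.scaleR_right scaleR_conv_of_real)

lemma has_derivative_scalar_multiple:
  fixes F :: "'a::complex_normed_vector \<Rightarrow> 'a"
  assumes "\<And>w. w \<in> ball 0 1 \<Longrightarrow> F w = f w *\<^sub>C w" and "(f has_derivative D) (at z)" and z: "z \<in> ball 0 1"
  shows "(F has_derivative (\<lambda>w. f z *\<^sub>C w + D w *\<^sub>C z)) (at z)"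
proof (rule has_derivative_transform_within_open[OF _ open_ball z])
  show "((\<lambda>w. f w *\<^sub>C w) has_derivative (\<lambda>w. f z *\<^sub>C w + D w *\<^sub>C z)) (at z)"
    by (rule bounded_bilinear.FDERIV[OF bounded_bilinear_scaleC assms(2) has_derivative_ident])
qed (simp add: assms(1))

lemma clinear_id_complex: "clinear (\<lambda>x::complex. x)"
  by (simp add: clinear_def linear_id[unfolded id_def])

lemma scaleC_eq_0_iff: "c *\<^sub>C x = 0 \<longleftrightarrow> c = 0 \<or> x = (0::'a::complex_normed_vector)"
  using norm_scaleC[of c x] by (metis mult_eq_0_iff norm_eq_zero)

text \<open>With \<open>s = g(\<zeta>) + \<zeta> g'(\<zeta>)\<close> one has \<open>DF(\<zeta> u) u = s u\<close>, and \<open>s \<noteq> 0\<close> by injectivity.  Hence the inverse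
  of \<open>DF(\<zeta> u)\<close> sends \<open>F(\<zeta> u) = \<zeta> g(\<zeta>) u\<close> to \<open>(g(\<zeta>) / s) \<zeta> u\<close>, and the starlikeness quotient for
  the support functional of \<open>\<zeta> u\<close> obtained by rotating \<open>l\<close> is \<open>s / g(\<zeta>)\<close>.\<close>

lemma scalar_starlike_restricts_to_starlike_function:
  fixes F :: "'a::complex_banach \<Rightarrow> 'a"
  assumes F: "scalar_starlike f F" and u: "norm u = 1" and l: "l \<in> support_functionals u"
    and \<zeta>: "\<zeta> \<in> ball 0 1" "\<zeta> \<noteq> 0"
  defines "g \<equiv> \<lambda>\<zeta>. f (\<zeta> *\<^sub>C u)"
  shows "(g \<zeta> + \<zeta> * deriv g \<zeta>) / g \<zeta> \<in> Phi ` ball 0 1"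
proof -
  have hol: "f Cholomorphic_on ball 0 1" and eq: "\<And>z. z \<in> ball 0 1 \<Longrightarrow> F z = f z *\<^sub>C z"
    and star: "F \<in> starlike_maps"
    using F by (auto simp: scalar_starlike_def)
  define z where "z = \<zeta> *\<^sub>C u"
  have nz: "norm z = cmod \<zeta>" by (simp add: z_def norm_scaleC u)
  then have z: "z \<in> ball 0 1" "z \<noteq> 0" using \<zeta> by auto
  define A where "A = blinfun_apply (fderiv F z)"
  have holF: "F Cholomorphic_on ball 0 1" and bij: "bij A"
    using star z by (auto simp: starlike_maps_def locally_biholomorphic_def A_def)
  have cA: "clinear A" unfolding A_def by (rule Cholomorphic_on_fderiv(2)[OF holF z(1)])
  have A: "A w = f z *\<^sub>C w + blinfun_apply (fderiv f z) w *\<^sub>C z" for w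
  proof -
    have "(F has_derivative (\<lambda>w. f z *\<^sub>C w + blinfun_apply (fderiv f z) w *\<^sub>C z)) (at z)"
      by (rule has_derivative_scalar_multiple[OF _ Cholomorphic_on_fderiv(1)[OF hol z(1)] z(1)]) (rule eq)
    then show ?thesis unfolding A_def by (simp only: fderiv_apply)
  qed
  have "(g has_field_derivative blinfun_apply (fderiv f z) u) (at \<zeta>)"
    using has_field_derivative_along_line[OF hol _ bounded_linear_ident clinear_id_complex, of 0 \<zeta> u] z
    by (simp add: g_def z_def)
  then have dg: "deriv g \<zeta> = blinfun_apply (fderiv f z) u" by (rule DERIV_imp_deriv)
  define s where "s = g \<zeta> + \<zeta> * deriv g \<zeta>"
  have Au: "A u = s *\<^sub>C u"
    unfolding A s_def dg by (simp add: g_def z_def scaleC_add_left scaleC_scaleC mult.commute)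
  have "u \<noteq> 0" using u by auto
  then have "A u \<noteq> 0" using injD[OF bij_is_inj[OF bij], of u 0] clinear_zero[OF cA] by auto
  then have s: "s \<noteq> 0" by (auto simp: Au scaleC_zero_left)
  define c where "c = g \<zeta> / s"
  have "A ((c * \<zeta>) *\<^sub>C u) = F z"
    unfolding eq[OF z(1)] clinear_scaleC[OF cA] Au
    using s by (simp add: z_def scaleC_scaleC c_def g_def)
  then have inv: "inv A (F z) = (c * \<zeta>) *\<^sub>C u" using inv_f_f[OF bij_is_inj[OF bij]] by metis
  let ?l = "(of_real (cmod \<zeta>) / \<zeta>) *\<^sub>C l"
  have l': "?l \<in> support_functionals z"
    unfolding z_def by (rule support_functionals_scaleC[OF l u \<zeta>(2)])
  have "clinear (blinfun_apply l)" "blinfun_apply l u = 1"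
    using l u by (auto simp: support_functionals_def)
  then have "blinfun_apply ?l (inv A (F z)) = of_real (cmod \<zeta>) * c"
    using \<zeta> by (simp add: inv scaleC_blinfun_apply clinear_scaleC scaleC_complex_def)
  then have "complex_of_real (norm z) / (of_real (cmod \<zeta>) * c) \<in> Phi ` ball 0 1"
    using star z l' by (fastforce simp: starlike_maps_def A_def)
  moreover have "complex_of_real (norm z) / (of_real (cmod \<zeta>) * c) = s / g \<zeta>"
    using \<zeta> by (simp add: nz c_def)
  ultimately show ?thesis by (simp add: s_def)
qed

lemma higher_deriv_eq_if_eq_on_ball:
  assumes "\<And>\<zeta>. \<zeta> \<in> ball 0 1 \<Longrightarrow> f \<zeta> = g \<zeta>"
  shows "(deriv ^^ n) f 0 = (deriv ^^ n) g (0::complex)"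
proof (rule higher_deriv_cong_ev)
  have "\<forall>\<^sub>F \<zeta> in nhds 0. \<zeta> \<in> ball (0::complex) 1" by (rule eventually_nhds_in_open) auto
  then show "\<forall>\<^sub>F \<zeta> in nhds 0. f \<zeta> = g \<zeta>" by eventually_elim (rule assms)
qed simp

lemma scalar_starlike_coefficient_inequality:
  fixes F :: "'a::complex_banach \<Rightarrow> 'a"
  assumes F: "scalar_starlike f F" and z: "z \<noteq> 0" and l: "l \<in> support_functionals z"
  shows "cmod (coeff2 F z l * coeff3 F z l - coeff4 F z l) \<le> 2"
proof -
  define u where "u = z /\<^sub>R norm z"
  have u: "norm u = 1" using z by (simp add: u_def)
  have lu: "l \<in> support_functionals u" unfolding u_def by (rule support_functionals_normalize[OF l z])
  have cl: "clinear (blinfun_apply l)" and l1: "blinfun_apply l u = 1"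
    using lu u by (auto simp: support_functionals_def)
  have hol: "f Cholomorphic_on ball 0 1" and f0: "f 0 = 1" and eq: "\<And>z. z \<in> ball 0 1 \<Longrightarrow> F z = f z *\<^sub>C z"
    and holF: "F Cholomorphic_on ball 0 1"
    using F by (auto simp: scalar_starlike_def starlike_maps_def normalized_def)
  define g where "g \<zeta> = f (\<zeta> *\<^sub>C u)" for \<zeta>
  have "(g has_field_derivative blinfun_apply (fderiv f (\<zeta> *\<^sub>C u)) u) (at \<zeta>)" if "\<zeta> \<in> ball 0 1" for \<zeta>
    using has_field_derivative_along_line[OF hol _ bounded_linear_ident clinear_id_complex, of 0 \<zeta> u] that u
    by (simp add: g_def[abs_def] norm_scaleC)
  then have holg: "g holomorphic_on ball 0 1"
    unfolding holomorphic_on_open[OF open_ball] by blast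
  have g0: "g 0 = 1" by (simp add: g_def scaleC_zero_left f0)
  have h: "(deriv ^^ n) (\<lambda>\<zeta>. blinfun_apply l (F (\<zeta> *\<^sub>C u))) 0 = (deriv ^^ n) (\<lambda>\<zeta>. \<zeta> * g \<zeta>) 0" for n
    by (rule higher_deriv_eq_if_eq_on_ball)
      (simp add: eq u norm_scaleC g_def clinear_scaleC[OF cl] scaleC_complex_def l1 mult.commute)
  have "cmod ((deriv ^^ 2) (\<lambda>\<zeta>. \<zeta> * g \<zeta>) 0 / fact 2 * ((deriv ^^ 3) (\<lambda>\<zeta>. \<zeta> * g \<zeta>) 0 / fact 3)
      - (deriv ^^ 4) (\<lambda>\<zeta>. \<zeta> * g \<zeta>) 0 / fact 4) \<le> 2"
    using scalar_starlike_restricts_to_starlike_function[OF F u lu]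
    by (intro starlike_coefficient_inequality[OF holg g0]) (simp add: g_def)
  then show ?thesis
    unfolding coeffs_eq_higher_deriv[OF holF z cl] h[unfolded u_def] by simp
qed

text \<open>The Sherman-Morrison formula for \<open>a I + b z \<otimes> l\<close>.\<close>

lemma rank_one_perturbation_inverse:
  fixes z :: "'a::complex_normed_vector"
  assumes l: "clinear l" and ac: "a * c = 1" and bd: "b * c = d * (a + b * l z)"
  defines "A \<equiv> \<lambda>w. a *\<^sub>C w + (b * l w) *\<^sub>C z" and "I \<equiv> \<lambda>y. c *\<^sub>C y - (d * l y) *\<^sub>C z"
  shows "A (I y) = y" and "I (A w) = w"
proof -
  have sc: "l (k *\<^sub>C x) = k * l x" for k x
    by (simp add: clinear_scaleC[OF l] scaleC_complex_def)
  have md: "k *\<^sub>C (x - y) = k *\<^sub>C x - k *\<^sub>C y" for k and x y :: 'a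
    using scaleC_add_right[of k "x - y" y] by simp
  have lI: "l (I y) = (c - d * l z) * l y" by (simp add: I_def clinear_diff[OF l] sc algebra_simps)
  have "A (I y) = (a * c) *\<^sub>C y + (b * ((c - d * l z) * l y) - a * (d * l y)) *\<^sub>C z"
    unfolding A_def lI unfolding I_def md scaleC_scaleC
    using scaleC_add_left[of "b * ((c - d * l z) * l y) - a * (d * l y)" "a * (d * l y)" z]
    by (simp add: algebra_simps)
  also have "b * ((c - d * l z) * l y) - a * (d * l y) = (b * c - d * (a + b * l z)) * l y"
    by (simp add: algebra_simps)
  finally show "A (I y) = y" by (simp add: ac bd scaleC_one scaleC_zero_left)
  have lA: "l (A w) = (a + b * l z) * l w" by (simp add: A_def clinear_add[OF l] sc algebra_simps)
  have "I (A w) = (c * a) *\<^sub>C w + (c * (b * l w) - d * ((a + b * l z) * l w)) *\<^sub>C z"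
    unfolding I_def lA unfolding A_def scaleC_add_right scaleC_scaleC
    using scaleC_add_left[of "c * (b * l w) - d * ((a + b * l z) * l w)" "d * ((a + b * l z) * l w)" z]
    by (simp add: algebra_simps)
  also have "c * (b * l w) - d * ((a + b * l z) * l w) = (b * c - d * (a + b * l z)) * l w"
    by (simp add: algebra_simps)
  finally show "I (A w) = w" using ac by (simp add: bd mult.commute[of c] scaleC_one scaleC_zero_left)
qed

lemma koebe_map_scalar_starlike:
  fixes u :: "'a::complex_banach"
  assumes u: "norm u = 1" and lu: "lu \<in> support_functionals u"
  defines "f \<equiv> \<lambda>z. 1 / (1 - blinfun_apply lu z)\<^sup>2"
  defines "F \<equiv> \<lambda>z. f z *\<^sub>C z"
  shows "scalar_starlike f F"
proof -
  let ?l = "blinfun_apply lu"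
  have cl: "clinear ?l" and nl: "norm lu = 1" using lu by (auto simp: support_functionals_def)
  have s: "cmod (?l z) < 1" "1 - ?l z \<noteq> 0" "1 + ?l z \<noteq> 0" if "z \<in> ball 0 1" for z
  proof -
    show "cmod (?l z) < 1" using norm_blinfun[of lu z] that by (simp add: nl)
    then have "?l z \<noteq> 1" "?l z \<noteq> - 1" by auto
    then show "1 - ?l z \<noteq> 0" "1 + ?l z \<noteq> 0" by (simp_all add: add_eq_0_iff)
  qed
  have df: "(f has_derivative (\<lambda>w. 2 / (1 - ?l z) ^ 3 * ?l w)) (at z)" if z: "z \<in> ball 0 1" for z
  proof -
    have "((\<lambda>s. inverse ((1 - s)\<^sup>2)) has_field_derivative 2 / (1 - ?l z) ^ 3) (at (?l z))"
      using s(2)[OF z]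
      by (auto intro!: derivative_eq_intros simp: divide_inverse power2_eq_square power3_eq_cube)
    then have "((\<lambda>s. inverse ((1 - s)\<^sup>2)) has_derivative (*) (2 / (1 - ?l z) ^ 3)) (at (?l z))"
      by (simp add: has_field_derivative_def)
    from has_derivative_compose[OF bounded_linear_imp_has_derivative[OF blinfun.bounded_linear_right] this]
    show ?thesis by (simp add: f_def[abs_def] inverse_eq_divide)
  qed
  have clD: "clinear (\<lambda>w. k * ?l w)" for k
    using linear_compose[OF bounded_linear.linear[OF blinfun.bounded_linear_right, of lu]
        bounded_linear.linear[OF bounded_linear_mult_right[of k]]]
    by (simp add: clinear_def o_def clinear_scaleC[OF cl] scaleC_complex_def)
  have holf: "f Cholomorphic_on ball 0 1"
    unfolding Cholomorphic_on_def using df clD by blast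
  have f0: "f 0 = 1" by (simp add: f_def)
  define A where "A z w = f z *\<^sub>C w + (2 / (1 - ?l z) ^ 3 * ?l w) *\<^sub>C z" for z w
  have dF: "(F has_derivative A z) (at z)" if "z \<in> ball 0 1" for z
    unfolding A_def by (rule has_derivative_scalar_multiple[OF _ df[OF that] that]) (simp add: F_def)
  have dFA: "blinfun_apply (fderiv F z) = A z" if "z \<in> ball 0 1" for z
    by (rule fderiv_apply[OF dF[OF that]])
  have clA: "clinear (A z)" if "z \<in> ball 0 1" for z
    using has_derivative_linear[OF dF[OF that]]
    by (simp add: clinear_def) (simp add: A_def clinear_scaleC[OF cl] scaleC_complex_def scaleC_scaleC scaleC_add_right mult_ac)
  have holF: "F Cholomorphic_on ball 0 1"
    unfolding Cholomorphic_on_def using dF clA by blast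
  \<comment> \<open>the solution \<open>w\<close> of \<open>A z w = y\<close>, found by first applying \<open>?l\<close> to both sides\<close>
  define I where "I z y = (1 - ?l z)\<^sup>2 *\<^sub>C y - (2 * (1 - ?l z)\<^sup>2 / (1 + ?l z) * ?l y) *\<^sub>C z" for z y
  have AI: "A z (I z y) = y" and IA: "I z (A z w) = w" if z: "z \<in> ball 0 1" for z y w
  proof -
    have ac: "f z * (1 - ?l z)\<^sup>2 = 1" using s[OF z] by (simp add: f_def)
    have bd: "2 / (1 - ?l z) ^ 3 * (1 - ?l z)\<^sup>2
        = 2 * (1 - ?l z)\<^sup>2 / (1 + ?l z) * (f z + 2 / (1 - ?l z) ^ 3 * ?l z)"
    proof -
      have "f z + 2 / (1 - ?l z) ^ 3 * ?l z = (1 + ?l z) / (1 - ?l z) ^ 3"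
      proof -
        have "1 / d\<^sup>2 + 2 / d ^ 3 * (1 - d) = (2 - d) / d ^ 3" if "d \<noteq> 0" for d :: complex
          using that by (simp add: field_simps power2_eq_square power3_eq_cube)
        from this[OF s(2)[OF z]] show ?thesis by (simp add: f_def)
      qed
      then show ?thesis using s[OF z] by simp
    qed
    show "A z (I z y) = y" "I z (A z w) = w"
      unfolding A_def I_def by (rule rank_one_perturbation_inverse[OF cl ac bd])+
  qed
  have bij: "bij (A z)" and invA: "inv (A z) = I z" if "z \<in> ball 0 1" for z
  proof -
    show "bij (A z)" by (rule bij_betw_byWitness[where f' = "I z"]) (use AI[OF that] IA[OF that] in auto)
    show "inv (A z) = I z" by (rule inv_equality) (use AI[OF that] IA[OF that] in auto)
  qed
  have blI: "bounded_linear (I z)" for z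
    unfolding I_def
    by (intro bounded_linear_sub bounded_linear_scaleC
        bounded_linear_compose[OF bounded_bilinear.bounded_linear_left[OF bounded_bilinear_scaleC]]
        bounded_linear_compose[OF bounded_linear_mult_right] blinfun.bounded_linear_right)
  have "normalized F"
    unfolding normalized_def
  proof (intro conjI holF)
    show "F 0 = 0" using scaleC_eq_0_iff[of "f 0" "0::'a"] by (simp add: F_def)
    show "fderiv F 0 = id_blinfun"
    proof (rule blinfun_eqI)
      fix w
      have "k *\<^sub>C (0::'a) = 0" for k using scaleC_eq_0_iff[of k "0::'a"] by simp
      then show "blinfun_apply (fderiv F 0) w = blinfun_apply id_blinfun w"
        by (simp add: dFA A_def f0 scaleC_one)
    qed
  qed
  moreover have "locally_biholomorphic F"
    unfolding locally_biholomorphic_def using holF bij invA blI by (auto simp: dFA)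
  moreover have "complex_of_real (norm z) / blinfun_apply l (inv (blinfun_apply (fderiv F z)) (F z)) \<in> Phi ` ball 0 1"
    if z: "z \<in> ball 0 1 - {0}" and l: "l \<in> support_functionals z" for z l
  proof -
    have zb: "z \<in> ball 0 1" using z by simp
    have l': "clinear (blinfun_apply l)" "blinfun_apply l z = of_real (norm z)"
      using l by (auto simp: support_functionals_def)
    have inv: "inv (blinfun_apply (fderiv F z)) (F z) = I z (F z)" by (simp only: dFA[OF zb] invA[OF zb])
    have "blinfun_apply l (inv (blinfun_apply (fderiv F z)) (F z))
        = ((1 - ?l z)\<^sup>2 * f z - 2 * (1 - ?l z)\<^sup>2 / (1 + ?l z) * (f z * ?l z)) * of_real (norm z)"
      unfolding inv by (simp add: I_def F_def clinear_diff[OF l'(1)] clinear_scaleC[OF l'(1)] clinear_scaleC[OF cl] scaleC_complex_def l'(2) algebra_simps)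
    also have "(1 - ?l z)\<^sup>2 * f z - 2 * (1 - ?l z)\<^sup>2 / (1 + ?l z) * (f z * ?l z) = (1 - ?l z) / (1 + ?l z)"
      using s[OF zb] by (simp add: f_def field_simps)
    finally have "complex_of_real (norm z) / blinfun_apply l (inv (blinfun_apply (fderiv F z)) (F z)) = Phi (?l z)"
      using z by (simp add: Phi_def)
    then show ?thesis using s(1)[OF zb] by auto
  qed
  ultimately have "F \<in> starlike_maps" by (auto simp: starlike_maps_def)
  then show ?thesis using holf f0 by (auto simp: scalar_starlike_def F_def)
qed

text \<open>Multiplying the power series by \<open>(1 - X)\<^sup>2\<close> gives \<open>X\<close>; the resulting recursion is solved
  by the coefficients \<open>n\<close>.\<close>

lemma koebe_function_coefficients:
  defines "k \<equiv> \<lambda>\<zeta>::complex. \<zeta> / (1 - \<zeta>)\<^sup>2"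
  shows "(deriv ^^ 2) k 0 / fact 2 = 2" "(deriv ^^ 3) k 0 / fact 3 = 3" "(deriv ^^ 4) k 0 / fact 4 = 4"
proof -
  have ne: "1 - \<zeta> \<noteq> 0" if "\<zeta> \<in> ball 0 1" for \<zeta> :: complex using that by auto
  have hol: "k holomorphic_on ball 0 1"
    unfolding k_def using ne by (intro holomorphic_intros) auto
  define H where "H = fps_expansion k 0"
  have H: "k has_fps_expansion H"
    unfolding H_def by (rule has_fps_expansion_fps_expansion[OF _ _ hol]) auto
  have "(\<lambda>\<zeta>. k \<zeta> * (1 - \<zeta>)\<^sup>2) has_fps_expansion H * (1 - fps_X)\<^sup>2"
    by (intro fps_expansion_intros H)
  then have "(H * (1 - fps_X)\<^sup>2) $ n = (deriv ^^ n) (\<lambda>\<zeta>. k \<zeta> * (1 - \<zeta>)\<^sup>2) 0 / fact n" for n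
    by (rule fps_nth_fps_expansion)
  moreover have "(deriv ^^ n) (\<lambda>\<zeta>. k \<zeta> * (1 - \<zeta>)\<^sup>2) 0 = (deriv ^^ n) (\<lambda>\<zeta>. \<zeta>) 0" for n
    by (rule higher_deriv_eq_if_eq_on_ball) (use ne in \<open>simp add: k_def\<close>)
  moreover have "fps_X $ n = (deriv ^^ n) (\<lambda>\<zeta>. \<zeta>) 0 / (fact n :: complex)" for n
    by (rule fps_nth_fps_expansion) (rule fps_expansion_intros)
  ultimately have "(H * (1 - fps_X)\<^sup>2) $ n = fps_X $ n" for n by metis
  moreover have "H * (1 - fps_X)\<^sup>2 = H - 2 * (fps_X * H) + fps_X * (fps_X * H)"
    by (simp add: power2_eq_square algebra_simps)
  ultimately have c: "(H - 2 * (fps_X * H) + fps_X * (fps_X * H)) $ n = fps_X $ n" for n by metis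
  have two: "(2 * (fps_X * H)) $ n = 2 * (fps_X * H) $ n" for n
    by (simp add: mult_2 flip: mult_2)
  have h0: "H $ 0 = 0" using c[of 0] by simp
  have h1: "H $ 1 = 1" using c[of 1] h0 by (simp add: two)
  have h2: "H $ 2 = 2" using c[of 2] h0 h1 by (simp add: two)
  have h3: "H $ 3 = 3" using c[of 3] h1 h2 by (simp add: two)
  have h4: "H $ 4 = 4" using c[of 4] h2 h3 by (simp add: two)
  show "(deriv ^^ 2) k 0 / fact 2 = 2" "(deriv ^^ 3) k 0 / fact 3 = 3" "(deriv ^^ 4) k 0 / fact 4 = 4"
    using h2 h3 h4 by (simp_all only: fps_nth_fps_expansion[OF H])
qed

lemma koebe_map_attains_equality:
  fixes u :: "'a::complex_banach"
  assumes u: "norm u = 1" and lu: "lu \<in> support_functionals u" and r: "0 < r"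
    and l: "l \<in> support_functionals (r *\<^sub>R u)"
  defines "F \<equiv> \<lambda>z. (1 / (1 - blinfun_apply lu z)\<^sup>2) *\<^sub>C z"
  shows "cmod (coeff2 F (r *\<^sub>R u) l * coeff3 F (r *\<^sub>R u) l - coeff4 F (r *\<^sub>R u) l) = 2"
proof -
  have u0: "u \<noteq> 0" using u by auto
  have z0: "r *\<^sub>R u \<noteq> 0" using u0 r by simp
  have zu: "(r *\<^sub>R u) /\<^sub>R norm (r *\<^sub>R u) = u" using r u by simp
  have "l \<in> support_functionals u" using support_functionals_normalize[OF l z0] by (simp only: zu)
  then have cl: "clinear (blinfun_apply l)" and l1: "blinfun_apply l u = 1"
    using u by (auto simp: support_functionals_def)
  have clu: "clinear (blinfun_apply lu)" and lu1: "blinfun_apply lu u = 1"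
    using lu u by (auto simp: support_functionals_def)
  have holF: "F Cholomorphic_on ball 0 1"
    using koebe_map_scalar_starlike[OF u lu]
    by (simp add: F_def scalar_starlike_def starlike_maps_def normalized_def)
  have h: "(\<lambda>\<zeta>. blinfun_apply l (F (\<zeta> *\<^sub>C u))) = (\<lambda>\<zeta>. \<zeta> / (1 - \<zeta>)\<^sup>2)"
    by (simp add: F_def clinear_scaleC[OF cl] clinear_scaleC[OF clu] scaleC_complex_def l1 lu1 fun_eq_iff)
  show ?thesis
    unfolding coeffs_eq_higher_deriv[OF holF z0 cl] zu h koebe_function_coefficients by simp
qed

theorem corollary7p1:
  assumes nonzero: "\<exists>x::'a::complex_banach. x \<noteq> 0"
  shows
    "(\<forall>f (F :: 'a \<Rightarrow> 'a). scalar_starlike f F \<longrightarrow>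
        (\<forall>z l. z \<noteq> 0 \<longrightarrow> l \<in> support_functionals z \<longrightarrow>
           cmod (coeff2 F z l * coeff3 F z l - coeff4 F z l) \<le> 2)) \<and>
     (\<forall>(u :: 'a) lu. norm u = 1 \<longrightarrow> lu \<in> support_functionals u \<longrightarrow>
        (let f = (\<lambda>z. 1 / (1 - blinfun_apply lu z)\<^sup>2); F = (\<lambda>z. f z *\<^sub>C z) in
           scalar_starlike f F \<and>
           (\<forall>r. 0 < r \<longrightarrow> r < 1 \<longrightarrow> (\<forall>l\<in>support_functionals (r *\<^sub>R u).
              cmod (coeff2 F (r *\<^sub>R u) l * coeff3 F (r *\<^sub>R u) l - coeff4 F (r *\<^sub>R u) l) = 2)))) \<and>
     (\<exists>f (F :: 'a \<Rightarrow> 'a) z l. scalar_starlike f F \<and> z \<noteq> 0 \<and> l \<in> support_functionals z \<and>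
        cmod (coeff2 F z l * coeff3 F z l - coeff4 F z l) = 2)"
proof (intro conjI)
  show "\<forall>f (F :: 'a \<Rightarrow> 'a). scalar_starlike f F \<longrightarrow>
        (\<forall>z l. z \<noteq> 0 \<longrightarrow> l \<in> support_functionals z \<longrightarrow>
           cmod (coeff2 F z l * coeff3 F z l - coeff4 F z l) \<le> 2)"
    using scalar_starlike_coefficient_inequality by blast
  show "\<forall>(u :: 'a) lu. norm u = 1 \<longrightarrow> lu \<in> support_functionals u \<longrightarrow>
        (let f = (\<lambda>z. 1 / (1 - blinfun_apply lu z)\<^sup>2); F = (\<lambda>z. f z *\<^sub>C z) in
           scalar_starlike f F \<and>
           (\<forall>r. 0 < r \<longrightarrow> r < 1 \<longrightarrow> (\<forall>l\<in>support_functionals (r *\<^sub>R u).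
              cmod (coeff2 F (r *\<^sub>R u) l * coeff3 F (r *\<^sub>R u) l - coeff4 F (r *\<^sub>R u) l) = 2)))"
    unfolding Let_def
    by (intro allI impI conjI ballI koebe_map_scalar_starlike koebe_map_attains_equality)
  obtain x :: 'a where "x \<noteq> 0" using nonzero by blast
  then obtain l where l: "l \<in> support_functionals x" by (rule support_functional_exists)
  define u where "u = x /\<^sub>R norm x"
  have u: "norm u = 1" "u \<noteq> 0" and lu: "l \<in> support_functionals u"
    using \<open>x \<noteq> 0\<close> support_functionals_normalize[OF l] by (simp_all add: u_def)
  show "\<exists>f (F :: 'a \<Rightarrow> 'a) z l. scalar_starlike f F \<and> z \<noteq> 0 \<and> l \<in> support_functionals z \<and>
        cmod (coeff2 F z l * coeff3 F z l - coeff4 F z l) = 2"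
    using koebe_map_scalar_starlike[OF u(1) lu] koebe_map_attains_equality[OF u(1) lu, of 1 l] lu u(2)
    by (simp only: scaleR_one zero_less_one) blast
qed

end
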